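(* For all $P,Q\in\mathbf{dqp}$, put $\langle P,Q\rangle=\sharp Pic(P,Q)$ and $\langle P,Q\rangle_<=\sharp Pic_<(P,Q)$, extended bilinearly to $\mathcal{H}_{\mathbf{dqp}}$. Then $\langle-,-\rangle_<$ and $\langle-,-\rangle$ are symmetric Hopf pairings on, respectively, $(\mathcal{H}_{\mathbf{dqp}},m,\Delta_<)$ and $(\mathcal{H}_{\mathbf{dqp}},m,\Delta)$. Moreover, for all $x,y\in\mathcal{H}_{\mathbf{dqp}}$: $$\langle x,y\rangle_<=\langle pos(x),pos(y)\rangle_<=\langle pos(x),pos(y)\rangle.$$
   Context: Fix an arbitrary field $K$. For a preorder $\leq_a$, write $i\sim_a j$ if $i\leq_a j$ and $j\leq_a i$, and $i<_a j$ if $i\leq_a j$ and not $i\sim_a j$. A double quasi-poset is a triple $P=(V(P),\leq_1,\leq_2)$ with $V(P)$ a finite set and $\leq_1,\leq_2$ two preorders on $V(P)$. An isomorphism is a bijection preserving and reflecting both preorders. $\mathbf{dqp}$ is the set of isomorphism classes of double quasi-posets, and $\mathcal{H}_{\mathbf{dqp}}$ is the $K$-vector space with basis $\mathbf{dqp}$, graded by cardinality. Product $m$: $PQ$ has underlying set $V(P)\sqcup V(Q)$; $i\leq_1 j$ in $PQ$ iff $i,j$ both lie in $V(P)$ and $i\leq_1 j$ in $P$, or both lie in $V(Q)$ and $i\leq_1 j$ in $Q$; $i\leq_2 j$ in $PQ$ iff ($i,j\in V(P)$ and $i\leq_2 j$ in $P$) or ($i,j\in V(Q)$ and $i\leq_2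 j$ in $Q$) or ($i\in V(P)$ and $j\in V(Q)$). The unit is the empty double quasi-poset $1$. For $X\subseteq V(P)$, $P_{\mid X}$ is the restriction of $P$ to $X$. $Top(P)$ is the set of $X$ such that $i\in X$, $i\leq_1 j$ imply $j\in X$; $Top_<(P)$ is the set of $X$ such that $i\in X$, $i<_1 j$ imply $j\in X$. The coproducts are $$\Delta(P)=\sum_{O\in Top(P)}P_{\mid V(P)\setminus O}\otimes P_{\mid O},\qquad \Delta_<(P)=\sum_{O\in Top_<(P)}P_{\mid V(P)\setminus O}\otimes P_{\mid O}.$$ Both $(\mathcal{H}_{\mathbf{dqp}},m,\Delta)$ and $(\mathcal{H}_{\mathbf{dqp}},m,\Delta_<)$ are graded connected Hopf algebras. The splitting of $P$ is $pos(P)=(V(P),\preceq_1,\preceq_2)$ where, for $a=1,2$, $i\preceq_a j$ iff $i<_a j$ or $i=j$; $pos$ is extended linearly. A prepicture between $P$ and $Q$ is a bijection $f:V(P)\to V(Q)$ such that for all $i,j\in V(P)$: $i<_1 j\Rightarrow f(i)<_2 f(j)$, and $f(i)<_1 f(j)\Rightarrow i<_2 j$. The set of prepictures is $Pic_<(P,Q)$. A picture between $P$ and $Q$ is a prepicture such that moreover for all $i,j\in V(P)$: $i\leq_1 j\Rightarrow f(i)\leq_2 f(j)$, and $f(i)\leq_1 f(j)\Rightarrow i\leq_2 j$. The set of pictures is $Pic(P,Q)$. A Hopf pairing on a Hopf algebra $(H,m,\Delta)$ with unit $1$ and counit $\varepsilon$ is a bilinear form with $\langle xy,z\rangle=\langle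 x\otimes y,\Delta(z)\rangle$, $\langle x,yz\rangle=\langle\Delta(x),y\otimes z\rangle$, $\langle 1,x\rangle=\langle x,1\rangle=\varepsilon(x)$ (where $\langle a\otimes b,c\otimes d\rangle=\langle a,c\rangle\langle b,d\rangle$). *)

theory Defs
  imports Complex_Main "HOL-Library.Poly_Mapping" "HOL-Library.FuncSet"
begin

section \<open>Double quasi-posets\<close>

typedef 'a dqposet =
  "{(V :: 'a set, r1 :: 'a rel, r2 :: 'a rel). finite V \<and> preorder_on V r1 \<and> preorder_on V r2}"
  by (rule exI[of _ "({}, {}, {})"]) (auto simp: preorder_on_def refl_on_def trans_def)

setup_lifting type_definition_dqposet

lift_definition verts :: "'a dqposet \<Rightarrow> 'a set" is "\<lambda>(V, r1, r2). V" .
lift_definition rel1 :: "'a dqposet \<Rightarrow> 'a rel" is "\<lambda>(V, r1, r2). r1" .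
lift_definition rel2 :: "'a dqposet \<Rightarrow> 'a rel" is "\<lambda>(V, r1, r2). r2" .

lemma finite_verts [simp, intro]: "finite (verts P)"
  by transfer auto

lemma preorder_rel1: "preorder_on (verts P) (rel1 P)"
  by transfer auto

lemma preorder_rel2: "preorder_on (verts P) (rel2 P)"
  by transfer auto

definition sim_rel :: "'a rel \<Rightarrow> 'a rel" where
  "sim_rel r = {(i, j). (i, j) \<in> r \<and> (j, i) \<in> r}"

definition strict_rel :: "'a rel \<Rightarrow> 'a rel" where
  "strict_rel r = {(i, j). (i, j) \<in> r \<and> (i, j) \<notin> sim_rel r}"

definition is_dq_iso :: "('a \<Rightarrow> 'b) \<Rightarrow> 'a dqposet \<Rightarrow> 'b dqposet \<Rightarrow> bool" where
  "is_dq_iso f P Q \<longleftrightarrow> bij_betw f (verts P) (verts Q) \<and>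
     (\<forall>i\<in>verts P. \<forall>j\<in>verts P.
        ((i, j) \<in> rel1 P \<longleftrightarrow> (f i, f j) \<in> rel1 Q) \<and> ((i, j) \<in> rel2 P \<longleftrightarrow> (f i, f j) \<in> rel2 Q))"

definition dq_iso :: "'a dqposet \<Rightarrow> 'b dqposet \<Rightarrow> bool" where
  "dq_iso P Q \<longleftrightarrow> (\<exists>f. is_dq_iso f P Q)"

lift_definition empty_dq :: "'a dqposet" is "({}, {}, {})"
  by (auto simp: preorder_on_def refl_on_def trans_def)

lift_definition restrict_dq :: "'a dqposet \<Rightarrow> 'a set \<Rightarrow> 'a dqposet" is
  "\<lambda>(V, r1, r2) X. (V \<inter> X, r1 \<inter> (X \<times> X), r2 \<inter> (X \<times> X))"
  by (auto simp: preorder_on_def refl_on_def trans_def)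

definition sum_rel :: "'a rel \<Rightarrow> 'b rel \<Rightarrow> ('a + 'b) rel" where
  "sum_rel r s = {(Inl i, Inl j) | i j. (i, j) \<in> r} \<union> {(Inr i, Inr j) | i j. (i, j) \<in> s}"

lemma sum_rel_simps [simp]:
  "(Inl i, Inl j) \<in> sum_rel r s \<longleftrightarrow> (i, j) \<in> r"
  "(Inr k, Inr l) \<in> sum_rel r s \<longleftrightarrow> (k, l) \<in> s"
  "(Inl i, Inr l) \<notin> sum_rel r s"
  "(Inr k, Inl j) \<notin> sum_rel r s"
  by (auto simp: sum_rel_def)

lemma sum_rel_subset:
  "r \<subseteq> V \<times> V \<Longrightarrow> s \<subseteq> W \<times> W \<Longrightarrow> sum_rel r s \<subseteq> (V <+> W) \<times> (V <+> W)"
  by (auto simp: sum_rel_def)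

lemma preorder_on_iff:
  "preorder_on V r \<longleftrightarrow> r \<subseteq> V \<times> V \<and> (\<forall>x\<in>V. (x, x) \<in> r) \<and>
     (\<forall>x y z. (x, y) \<in> r \<longrightarrow> (y, z) \<in> r \<longrightarrow> (x, z) \<in> r)"
  unfolding preorder_on_def refl_on_def trans_def by blast

lemma preorder_sum_rel:
  assumes "preorder_on V r" "preorder_on W s"
  shows "preorder_on (V <+> W) (sum_rel r s)"
  unfolding preorder_on_iff
proof (intro conjI allI impI ballI)
  show "sum_rel r s \<subseteq> (V <+> W) \<times> (V <+> W)"
    using assms by (intro sum_rel_subset) (simp_all add: preorder_on_iff)
  show "(x, x) \<in> sum_rel r s" if "x \<in> V <+> W" for x
    using that assms by (cases x) (auto simp: preorder_on_iff)
  have r: "(i, k) \<in> r" if "(i, j) \<in> r" "(j, k) \<in> r" for i j k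
    using that assms unfolding preorder_on_iff by blast
  have s: "(i, k) \<in> s" if "(i, j) \<in> s" "(j, k) \<in> s" for i j k
    using that assms unfolding preorder_on_iff by blast
  show "(x, z) \<in> sum_rel r s" if "(x, y) \<in> sum_rel r s" "(y, z) \<in> sum_rel r s" for x y z
    using that by (cases x; cases y; cases z; simp; blast intro: r s)
qed

lemma preorder_sum_rel_ordered:
  assumes "preorder_on V r" "preorder_on W s"
  shows "preorder_on (V <+> W) (sum_rel r s \<union> {(Inl i, Inr j) | i j. i \<in> V \<and> j \<in> W})"
    (is "preorder_on _ (_ \<union> ?C)")
  unfolding preorder_on_iff
proof (intro conjI allI impI ballI)
  have "sum_rel r s \<subseteq> (V <+> W) \<times> (V <+> W)"
    using assms by (intro sum_rel_subset) (simp_all add: preorder_on_iff)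
  then show "sum_rel r s \<union> ?C \<subseteq> (V <+> W) \<times> (V <+> W)"
    by auto
  show "(x, x) \<in> sum_rel r s \<union> ?C" if "x \<in> V <+> W" for x
    using that assms by (cases x) (auto simp: preorder_on_iff)
  have r: "(i, k) \<in> r" if "(i, j) \<in> r" "(j, k) \<in> r" for i j k
    using that assms unfolding preorder_on_iff by blast
  have s: "(i, k) \<in> s" if "(i, j) \<in> s" "(j, k) \<in> s" for i j k
    using that assms unfolding preorder_on_iff by blast
  have V: "i \<in> V" if "(i, j) \<in> r" for i j using that assms unfolding preorder_on_iff by blast
  have W: "j \<in> W" if "(i, j) \<in> s" for i j using that assms unfolding preorder_on_iff by blast
  show "(x, z) \<in> sum_rel r s \<union> ?C"
    if "(x, y) \<in> sum_rel r s \<union> ?C" "(y, z) \<in> sum_rel r s \<union> ?C" for x y z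
    using that by (cases x; cases y; cases z; simp; blast intro: r s V W)
qed

lift_definition prod_dq :: "'a dqposet \<Rightarrow> 'b dqposet \<Rightarrow> ('a + 'b) dqposet" is
  "\<lambda>(V, r1, r2) (W, s1, s2).
     (V <+> W, sum_rel r1 s1, sum_rel r2 s2 \<union> {(Inl i, Inr j) | i j. i \<in> V \<and> j \<in> W})"
  by (auto intro: preorder_sum_rel preorder_sum_rel_ordered)

lemma preorder_strict_rel_Id:
  assumes "preorder_on V r"
  shows "preorder_on V (strict_rel r \<union> Id_on V)"
  unfolding preorder_on_iff
proof (intro conjI allI impI ballI)
  show "strict_rel r \<union> Id_on V \<subseteq> V \<times> V"
    using assms by (auto simp: preorder_on_iff strict_rel_def)
  show "(x, x) \<in> strict_rel r \<union> Id_on V" if "x \<in> V" for x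
    using that by auto
  have r: "(i, k) \<in> r" if "(i, j) \<in> r" "(j, k) \<in> r" for i j k
    using that assms unfolding preorder_on_iff by blast
  show "(x, z) \<in> strict_rel r \<union> Id_on V"
    if "(x, y) \<in> strict_rel r \<union> Id_on V" "(y, z) \<in> strict_rel r \<union> Id_on V" for x y z
    using that r[of x y z] r[of y z x] unfolding strict_rel_def sim_rel_def by auto
qed

lift_definition split_dq :: "'a dqposet \<Rightarrow> 'a dqposet" is
  "\<lambda>(V, r1, r2). (V, strict_rel r1 \<union> Id_on V, strict_rel r2 \<union> Id_on V)"
  by (auto intro: preorder_strict_rel_Id)

definition upsets :: "'a set \<Rightarrow> 'a rel \<Rightarrow> 'a set set" where
  "upsets V r = {X. X \<subseteq> V \<and> (\<forall>i\<in>X. \<forall>j\<in>V. (i, j) \<in> r \<longrightarrow> j \<in> X)}"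

definition Top :: "'a dqposet \<Rightarrow> 'a set set" where
  "Top P = upsets (verts P) (rel1 P)"

definition Top_strict :: "'a dqposet \<Rightarrow> 'a set set" where
  "Top_strict P = upsets (verts P) (strict_rel (rel1 P))"

text \<open>Maps are taken extensional (\<open>undefined\<close> off \<open>verts P\<close>), so that each bijection
  \<open>V(P) \<rightarrow> V(Q)\<close> is counted once.\<close>

definition Pic_strict :: "'a dqposet \<Rightarrow> 'b dqposet \<Rightarrow> ('a \<Rightarrow> 'b) set" where
  "Pic_strict P Q = {f \<in> verts P \<rightarrow>\<^sub>E verts Q. bij_betw f (verts P) (verts Q) \<and>
     (\<forall>i\<in>verts P. \<forall>j\<in>verts P.
        ((i, j) \<in> strict_rel (rel1 P) \<longrightarrow> (f i, f j) \<in> strict_rel (rel2 Q)) \<and>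
        ((f i, f j) \<in> strict_rel (rel1 Q) \<longrightarrow> (i, j) \<in> strict_rel (rel2 P)))}"

definition Pic :: "'a dqposet \<Rightarrow> 'b dqposet \<Rightarrow> ('a \<Rightarrow> 'b) set" where
  "Pic P Q = {f \<in> Pic_strict P Q.
     \<forall>i\<in>verts P. \<forall>j\<in>verts P.
        ((i, j) \<in> rel1 P \<longrightarrow> (f i, f j) \<in> rel2 Q) \<and>
        ((f i, f j) \<in> rel1 Q \<longrightarrow> (i, j) \<in> rel2 P)}"

lemma verts_empty_dq [simp]: "verts empty_dq = {}"
  by transfer simp

lemma verts_restrict_dq [simp]: "verts (restrict_dq P X) = verts P \<inter> X"
  and rel1_restrict_dq [simp]: "rel1 (restrict_dq P X) = rel1 P \<inter> (X \<times> X)"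
  and rel2_restrict_dq [simp]: "rel2 (restrict_dq P X) = rel2 P \<inter> (X \<times> X)"
  by (transfer; auto)+

lemma verts_prod_dq [simp]: "verts (prod_dq P Q) = verts P <+> verts Q"
  and rel1_prod_dq: "rel1 (prod_dq P Q) = sum_rel (rel1 P) (rel1 Q)"
  and rel2_prod_dq: "rel2 (prod_dq P Q) =
    sum_rel (rel2 P) (rel2 Q) \<union> {(Inl i, Inr j) | i j. i \<in> verts P \<and> j \<in> verts Q}"
  by (transfer; auto)+

lemma verts_split_dq [simp]: "verts (split_dq P) = verts P"
  and rel1_split_dq: "rel1 (split_dq P) = strict_rel (rel1 P) \<union> Id_on (verts P)"
  and rel2_split_dq: "rel2 (split_dq P) = strict_rel (rel2 P) \<union> Id_on (verts P)"
  by (transfer; auto)+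


section \<open>Isomorphism classes\<close>

lemma dq_iso_refl [simp]: "dq_iso P P"
  unfolding dq_iso_def is_dq_iso_def by (rule exI[of _ id]) auto

lemma is_dq_iso_inv:
  assumes "is_dq_iso f P Q"
  shows "is_dq_iso (inv_into (verts P) f) Q P"
proof -
  have b: "bij_betw f (verts P) (verts Q)" using assms by (simp add: is_dq_iso_def)
  have "inv_into (verts P) f i \<in> verts P" "f (inv_into (verts P) f i) = i" if "i \<in> verts Q" for i
    using that b by (auto simp: bij_betw_def inv_into_into f_inv_into_f)
  then show ?thesis
    using assms b unfolding is_dq_iso_def by (auto simp: bij_betw_inv_into)
qed

lemma dq_iso_sym: "dq_iso P Q \<Longrightarrow> dq_iso Q P"
  unfolding dq_iso_def using is_dq_iso_inv by blast

lemma is_dq_iso_comp: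
  assumes "is_dq_iso f P Q" "is_dq_iso g Q R"
  shows "is_dq_iso (g \<circ> f) P R"
proof -
  have "f i \<in> verts Q" if "i \<in> verts P" for i
    using that assms(1) by (auto simp: is_dq_iso_def bij_betw_def)
  then show ?thesis
    using assms unfolding is_dq_iso_def by (auto intro: bij_betw_trans)
qed

lemma dq_iso_trans: "dq_iso P Q \<Longrightarrow> dq_iso Q R \<Longrightarrow> dq_iso P R"
  unfolding dq_iso_def using is_dq_iso_comp by blast

text \<open>Every finite double quasi-poset is isomorphic to one on a subset of \<open>nat\<close>
  (see \<open>ex_nat_dqposet\<close> below), so the classes over \<open>nat\<close> are all the classes.\<close>

quotient_type dqp = "nat dqposet" / "dq_iso :: nat dqposet \<Rightarrow> nat dqposet \<Rightarrow> bool"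
  morphisms rep_dqp abs_dqp
proof (rule equivpI)
  show "reflp (dq_iso :: nat dqposet \<Rightarrow> _)" by (simp add: reflp_def)
  show "symp (dq_iso :: nat dqposet \<Rightarrow> _)" by (auto intro: sympI dq_iso_sym)
  show "transp (dq_iso :: nat dqposet \<Rightarrow> _)" by (auto intro: transpI dq_iso_trans)
qed

lemma ex_nat_dqposet: "\<exists>N :: nat dqposet. dq_iso P N"
proof -
  obtain f :: "'a \<Rightarrow> nat" where f: "inj_on f (verts P)"
    using finite_imp_inj_to_nat_seg[OF finite_verts, of P] by blast
  define im where "im r = (\<lambda>(i, j). (f i, f j)) ` r" for r
  have sub: "rel1 P \<subseteq> verts P \<times> verts P" "rel2 P \<subseteq> verts P \<times> verts P"
    using preorder_rel1[of P] preorder_rel2[of P] by (auto simp: preorder_on_def)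
  have im: "(f i, f j) \<in> im r \<longleftrightarrow> (i, j) \<in> r"
    if "i \<in> verts P" "j \<in> verts P" "r \<subseteq> verts P \<times> verts P" for i j r
  proof
    assume "(f i, f j) \<in> im r"
    then obtain i' j' where "(i', j') \<in> r" "f i = f i'" "f j = f j'" unfolding im_def by auto
    moreover from this have "i = i'" "j = j'"
      using that by (auto intro: inj_onD[OF f])
    ultimately show "(i, j) \<in> r" by simp
  qed (force simp: im_def)
  have pre: "preorder_on (f ` verts P) (im r)" if "preorder_on (verts P) r" for r
  proof -
    have r: "r \<subseteq> verts P \<times> verts P" "refl_on (verts P) r" "trans r"
      using that by (auto simp: preorder_on_def)
    have "trans (im r)"
    proof (rule transI)
      fix x y z assume "(x, y) \<in> im r" "(y, z) \<in> im r"
      then obtain i j j' k where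
        *: "(i, j) \<in> r" "(j', k) \<in> r" "x = f i" "y = f j" "y = f j'" "z = f k"
        unfolding im_def by auto
      then have "j = j'" using r(1) by (intro inj_onD[OF f]) auto
      with * have "(i, k) \<in> r" using transD[OF r(3)] by blast
      with * show "(x, z) \<in> im r" unfolding im_def by auto
    qed
    moreover have "im r \<subseteq> f ` verts P \<times> f ` verts P" using r(1) unfolding im_def by auto
    moreover have "refl_on (f ` verts P) (im r)"
      using r(2) unfolding im_def refl_on_def by (force simp: image_iff)
    ultimately show ?thesis by (simp add: preorder_on_def)
  qed
  define t where "t = (f ` verts P, im (rel1 P), im (rel2 P))"
  have t: "t \<in> {(V, r1, r2). finite V \<and> preorder_on V r1 \<and> preorder_on V r2}"
    unfolding t_def using pre[OF preorder_rel1] pre[OF preorder_rel2] by auto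
  have "is_dq_iso f P (Abs_dqposet t)"
    unfolding is_dq_iso_def verts.rep_eq rel1.rep_eq rel2.rep_eq Abs_dqposet_inverse[OF t]
    using f im[OF _ _ sub(1)] im[OF _ _ sub(2)] by (auto simp: t_def bij_betw_def)
      (simp_all add: verts.rep_eq rel1.rep_eq rel2.rep_eq)
  then show ?thesis unfolding dq_iso_def by blast
qed

definition iso_class :: "'a dqposet \<Rightarrow> dqp" where
  "iso_class P = abs_dqp (SOME N. dq_iso P N)"

lemma dq_iso_some_nat: "dq_iso P (SOME N :: nat dqposet. dq_iso P N)"
  by (rule someI_ex[OF ex_nat_dqposet])

lemma iso_class_eq_iff: "iso_class P = iso_class Q \<longleftrightarrow> dq_iso P Q"
  unfolding iso_class_def dqp.abs_eq_iff
  by (meson dq_iso_some_nat dq_iso_sym dq_iso_trans)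

lemma iso_class_nat [simp]: "iso_class N = abs_dqp N"
  unfolding iso_class_def dqp.abs_eq_iff by (rule dq_iso_sym[OF dq_iso_some_nat])

lemma is_dq_iso_strict:
  assumes "is_dq_iso f P Q" "i \<in> verts P" "j \<in> verts P"
  shows "(f i, f j) \<in> strict_rel (rel1 Q) \<longleftrightarrow> (i, j) \<in> strict_rel (rel1 P)"
    and "(f i, f j) \<in> strict_rel (rel2 Q) \<longleftrightarrow> (i, j) \<in> strict_rel (rel2 P)"
  using assms by (auto simp: is_dq_iso_def strict_rel_def sim_rel_def)

lemma is_dq_iso_restrict:
  assumes "is_dq_iso f P Q" "X \<subseteq> verts P"
  shows "is_dq_iso f (restrict_dq P X) (restrict_dq Q (f ` X))"
proof -
  have inj: "inj_on f (verts P)" and im: "f ` verts P = verts Q"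
    using assms(1) by (auto simp: is_dq_iso_def bij_betw_def)
  have "verts P \<inter> X = X" "verts Q \<inter> f ` X = f ` X" using assms(2) im by auto
  then show ?thesis
    using assms inj_on_subset[OF inj assms(2)]
    unfolding is_dq_iso_def by (auto simp: bij_betw_def subset_iff)
qed

lemma prod_dq_iso:
  assumes "dq_iso P P'" "dq_iso Q Q'"
  shows "dq_iso (prod_dq P Q) (prod_dq P' Q')"
proof -
  obtain f g where f: "is_dq_iso f P P'" and g: "is_dq_iso g Q Q'"
    using assms by (auto simp: dq_iso_def)
  have "f i \<in> verts P'" if "i \<in> verts P" for i
    using that f by (auto simp: is_dq_iso_def bij_betw_def)
  moreover have "g i \<in> verts Q'" if "i \<in> verts Q" for i
    using that g by (auto simp: is_dq_iso_def bij_betw_def)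
  moreover have "bij_betw (map_sum f g) (verts P <+> verts Q) (verts P' <+> verts Q')"
  proof -
    have fg: "inj_on f (verts P)" "f ` verts P = verts P'" "inj_on g (verts Q)" "g ` verts Q = verts Q'"
      using f g by (auto simp: is_dq_iso_def bij_betw_def)
    have "inj_on (map_sum f g) (verts P <+> verts Q)"
      by (rule inj_onI) (auto elim!: PlusE dest: inj_onD[OF fg(1)] inj_onD[OF fg(3)])
    moreover have "map_sum f g ` (verts P <+> verts Q) = f ` verts P <+> g ` verts Q"
      unfolding Plus_def image_Un image_image by simp
    ultimately show ?thesis by (simp only: bij_betw_def fg)
  qed
  ultimately have "is_dq_iso (map_sum f g) (prod_dq P Q) (prod_dq P' Q')"
    using f g unfolding is_dq_iso_def
    by (auto simp: rel1_prod_dq rel2_prod_dq sum_rel_def)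
  then show ?thesis unfolding dq_iso_def by blast
qed

lemma split_dq_iso: "dq_iso P Q \<Longrightarrow> dq_iso (split_dq P) (split_dq Q)"
proof -
  assume "dq_iso P Q"
  then obtain f where f: "is_dq_iso f P Q" by (auto simp: dq_iso_def)
  then have b: "inj_on f (verts P)" "f ` verts P = verts Q" "bij_betw f (verts P) (verts Q)"
    by (auto simp: is_dq_iso_def bij_betw_def)
  then have "(i, j) \<in> Id_on (verts P) \<longleftrightarrow> (f i, f j) \<in> Id_on (verts Q)"
    if "i \<in> verts P" "j \<in> verts P" for i j
    using that by (auto simp: inj_on_def)
  then have "is_dq_iso f (split_dq P) (split_dq Q)"
    using b(3) is_dq_iso_strict[OF f] unfolding is_dq_iso_def
    by (simp add: rel1_split_dq rel2_split_dq)
  then show ?thesis unfolding dq_iso_def by blast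
qed

lemma upsets_iso:
  assumes "bij_betw f V W"
    and "\<And>i j. i \<in> V \<Longrightarrow> j \<in> V \<Longrightarrow> (f i, f j) \<in> s \<longleftrightarrow> (i, j) \<in> r"
  shows "upsets W s = (`) f ` upsets V r"
proof (intro equalityI subsetI)
  have inj: "inj_on f V" and im: "f ` V = W" using assms(1) by (auto simp: bij_betw_def)
  {
    fix Y assume Y: "Y \<in> upsets W s"
    define X where "X = {i \<in> V. f i \<in> Y}"
    have "f ` X = Y" using Y im unfolding X_def upsets_def by auto
    moreover have "X \<in> upsets V r"
      using Y assms(2) im unfolding X_def upsets_def by auto
    ultimately show "Y \<in> (`) f ` upsets V r" by blast
  next
    fix Y assume "Y \<in> (`) f ` upsets V r"
    then obtain X where X: "X \<in> upsets V r" "Y = f ` X" by auto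
    then have sub: "X \<subseteq> V" and up: "\<And>i j. i \<in> X \<Longrightarrow> j \<in> V \<Longrightarrow> (i, j) \<in> r \<Longrightarrow> j \<in> X"
      by (auto simp: upsets_def)
    have "f j \<in> f ` X" if "i \<in> X" "j \<in> V" "(f i, f j) \<in> s" for i j
      using up[OF that(1,2)] that sub assms(2)[of i j] by blast
    with sub show "Y \<in> upsets W s"
      unfolding X(2) upsets_def im[symmetric] by blast
  }
qed

lemma card_pictures_iso_le:
  assumes "is_dq_iso g P P'" "is_dq_iso h Q Q'"
  shows "card (Pic_strict P' Q') \<le> card (Pic_strict P Q)" "card (Pic P' Q') \<le> card (Pic P Q)"
proof -
  define h' where "h' = inv_into (verts Q) h"
  have h': "is_dq_iso h' Q' Q" unfolding h'_def by (rule is_dq_iso_inv[OF assms(2)])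
  have bg: "bij_betw g (verts P) (verts P')" and bh: "bij_betw h' (verts Q') (verts Q)"
    using assms(1) h' by (auto simp: is_dq_iso_def)
  have g_in: "g i \<in> verts P'" if "i \<in> verts P" for i
    using that bg by (auto simp: bij_betw_def)
  define F where "F f = restrict (h' \<circ> f \<circ> g) (verts P)" for f
  have maps: "F f \<in> verts P \<rightarrow>\<^sub>E verts Q" "bij_betw (F f) (verts P) (verts Q)"
    if "bij_betw f (verts P') (verts Q')" for f
  proof -
    have "bij_betw (h' \<circ> f \<circ> g) (verts P) (verts Q)"
      using that bg bh by (auto intro: bij_betw_trans)
    moreover have "bij_betw (F f) (verts P) (verts Q) \<longleftrightarrow>
        bij_betw (h' \<circ> f \<circ> g) (verts P) (verts Q)"
      by (rule bij_betw_cong) (simp add: F_def)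
    ultimately show "bij_betw (F f) (verts P) (verts Q)" by simp
    then show "F f \<in> verts P \<rightarrow>\<^sub>E verts Q"
      unfolding F_def by (auto simp: bij_betw_def)
  qed
  have F1: "F f \<in> Pic_strict P Q" if "f \<in> Pic_strict P' Q'" for f
  proof -
    have bf: "bij_betw f (verts P') (verts Q')" using that by (simp add: Pic_strict_def)
    have f_in: "f i \<in> verts Q'" if "i \<in> verts P'" for i
      using that bf by (auto simp: bij_betw_def)
    show ?thesis
      using that maps[OF bf] unfolding Pic_strict_def
      by (auto simp: F_def g_in f_in is_dq_iso_strict[OF h'] is_dq_iso_strict[OF assms(1), symmetric])
  qed
  have F2: "F f \<in> Pic P Q" if "f \<in> Pic P' Q'" for f
  proof -
    have fs: "f \<in> Pic_strict P' Q'" using that by (simp add: Pic_def)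
    then have bf: "bij_betw f (verts P') (verts Q')" by (simp add: Pic_strict_def)
    have f_in: "f i \<in> verts Q'" if "i \<in> verts P'" for i
      using that bf by (auto simp: bij_betw_def)
    have rg: "(i, j) \<in> rel1 P \<longleftrightarrow> (g i, g j) \<in> rel1 P'" "(i, j) \<in> rel2 P \<longleftrightarrow> (g i, g j) \<in> rel2 P'"
      if "i \<in> verts P" "j \<in> verts P" for i j
      using that assms(1) by (auto simp: is_dq_iso_def)
    have rh: "(h' i, h' j) \<in> rel1 Q \<longleftrightarrow> (i, j) \<in> rel1 Q'" "(h' i, h' j) \<in> rel2 Q \<longleftrightarrow> (i, j) \<in> rel2 Q'"
      if "i \<in> verts Q'" "j \<in> verts Q'" for i j
      using that h' by (auto simp: is_dq_iso_def)
    show ?thesis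
      using that F1[OF fs] unfolding Pic_def by (auto simp: F_def g_in f_in rg rh)
  qed
  have inj: "inj_on F (Pic_strict P' Q')"
  proof (rule inj_onI)
    fix f f' assume f: "f \<in> Pic_strict P' Q'" and f': "f' \<in> Pic_strict P' Q'" and eq: "F f = F f'"
    show "f = f'"
    proof (rule PiE_ext)
      show "f \<in> verts P' \<rightarrow>\<^sub>E verts Q'" "f' \<in> verts P' \<rightarrow>\<^sub>E verts Q'"
        using f f' by (auto simp: Pic_strict_def)
      fix k assume "k \<in> verts P'"
      then obtain i where i: "i \<in> verts P" "k = g i" using bg by (auto simp: bij_betw_def)
      have "h' (f k) = h' (f' k)" using fun_cong[OF eq, of i] i by (simp add: F_def)
      moreover have "f k \<in> verts Q'" "f' k \<in> verts Q'"
        using f f' \<open>k \<in> verts P'\<close> by (auto simp: Pic_strict_def)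
      ultimately show "f k = f' k" using bh by (auto simp: bij_betw_def inj_on_def)
    qed
  qed
  have fin: "finite (Pic_strict P Q)"
    by (rule finite_subset[of _ "verts P \<rightarrow>\<^sub>E verts Q"]) (auto simp: Pic_strict_def intro: finite_PiE)
  show "card (Pic_strict P' Q') \<le> card (Pic_strict P Q)"
    by (rule card_inj_on_le[OF inj _ fin]) (use F1 in auto)
  show "card (Pic P' Q') \<le> card (Pic P Q)"
  proof (rule card_inj_on_le)
    show "inj_on F (Pic P' Q')" by (rule inj_on_subset[OF inj]) (auto simp: Pic_def)
    show "finite (Pic P Q)" by (rule finite_subset[OF _ fin]) (auto simp: Pic_def)
  qed (use F2 in auto)
qed

lemma card_pictures_iso:
  assumes "dq_iso P P'" "dq_iso Q Q'"
  shows "card (Pic_strict P Q) = card (Pic_strict P' Q')" "card (Pic P Q) = card (Pic P' Q')"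
proof -
  obtain g h where gh: "is_dq_iso g P P'" "is_dq_iso h Q Q'"
    using assms by (auto simp: dq_iso_def)
  note le = card_pictures_iso_le[OF gh]
    card_pictures_iso_le[OF is_dq_iso_inv[OF gh(1)] is_dq_iso_inv[OF gh(2)]]
  show "card (Pic_strict P Q) = card (Pic_strict P' Q')" "card (Pic P Q) = card (Pic P' Q')"
    using le by (auto intro: antisym)
qed

text \<open>The product of classes is written additively and the empty class is \<open>0\<close>: the type
  \<open>'b \<Rightarrow>\<^sub>0 'k\<close> with its library multiplication \<open>*\<close> is the monoid algebra of an additively written
  (here non-commutative) monoid, so that \<open>dqp \<Rightarrow>\<^sub>0 'k\<close> carries exactly the product \<open>m\<close>.\<close>

instantiation dqp :: monoid_add
begin

lift_definition zero_dqp :: dqp is empty_dq .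

lift_definition plus_dqp :: "dqp \<Rightarrow> dqp \<Rightarrow> dqp" is
  "\<lambda>P Q. SOME N. dq_iso (prod_dq P Q) N"
  by (meson prod_dq_iso dq_iso_some_nat dq_iso_sym dq_iso_trans)

lemma plus_iso_class: "iso_class P + iso_class Q = iso_class (prod_dq P Q)"
proof -
  let ?P = "SOME N :: nat dqposet. dq_iso P N" and ?Q = "SOME N :: nat dqposet. dq_iso Q N"
  have "iso_class P + iso_class Q = iso_class (prod_dq ?P ?Q)"
    by (simp add: iso_class_def plus_dqp.abs_eq)
  also have "\<dots> = iso_class (prod_dq P Q)"
    unfolding iso_class_eq_iff
    by (rule dq_iso_sym[OF prod_dq_iso[OF dq_iso_some_nat dq_iso_some_nat]])
  finally show ?thesis .
qed

lemma zero_iso_class: "iso_class (empty_dq :: 'a dqposet) = 0"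
proof -
  have "dq_iso (empty_dq :: 'a dqposet) (empty_dq :: nat dqposet)"
    by (auto simp: dq_iso_def is_dq_iso_def bij_betw_def)
  then have "iso_class (empty_dq :: 'a dqposet) = iso_class (empty_dq :: nat dqposet)"
    by (simp only: iso_class_eq_iff)
  then show ?thesis by (simp add: zero_dqp_def)
qed

instance
proof
  have cls: "\<exists>N :: nat dqposet. a = iso_class N" for a
    by (induct a rule: dqp.abs_induct) (metis iso_class_nat)
  fix a b c :: dqp
  obtain A B C :: "nat dqposet" where
    abc: "a = iso_class A" "b = iso_class B" "c = iso_class C" using cls by meson
  let ?f = "case_sum (case_sum Inl (Inr \<circ> Inl)) (Inr \<circ> Inr) :: (nat + nat) + nat \<Rightarrow> _"
  have "bij_betw ?f ((verts A <+> verts B) <+> verts C) (verts A <+> (verts B <+> verts C))"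
    by (rule bij_betw_byWitness[where f' = "case_sum (Inl \<circ> Inl) (case_sum (Inl \<circ> Inr) Inr)"]) auto
  then have "is_dq_iso ?f (prod_dq (prod_dq A B) C) (prod_dq A (prod_dq B C))"
    unfolding is_dq_iso_def by (auto simp: rel1_prod_dq rel2_prod_dq sum_rel_def)
  then have "dq_iso (prod_dq (prod_dq A B) C) (prod_dq A (prod_dq B C))"
    unfolding dq_iso_def by blast
  then show "a + b + c = a + (b + c)"
    by (simp only: abc plus_iso_class iso_class_eq_iff)
  have z: "(0 :: dqp) = iso_class (empty_dq :: nat dqposet)" by (rule zero_iso_class[symmetric])
  have "bij_betw (case_sum id id) ({} <+> verts A) (verts A)"
    by (rule bij_betw_byWitness[where f' = Inr]) auto
  then have "is_dq_iso (case_sum id id) (prod_dq (empty_dq :: nat dqposet) A) A"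
    unfolding is_dq_iso_def by (auto simp: rel1_prod_dq rel2_prod_dq sum_rel_def)
  then have "dq_iso (prod_dq (empty_dq :: nat dqposet) A) A" unfolding dq_iso_def by blast
  then show "0 + a = a" by (simp only: abc z plus_iso_class iso_class_eq_iff)
  have "bij_betw (case_sum id id) (verts A <+> {}) (verts A)"
    by (rule bij_betw_byWitness[where f' = Inl]) auto
  then have "is_dq_iso (case_sum id id) (prod_dq A (empty_dq :: nat dqposet)) A"
    unfolding is_dq_iso_def by (auto simp: rel1_prod_dq rel2_prod_dq sum_rel_def)
  then have "dq_iso (prod_dq A (empty_dq :: nat dqposet)) A" unfolding dq_iso_def by blast
  then show "a + 0 = a" by (simp only: abc z plus_iso_class iso_class_eq_iff)
qed

end

lift_definition pos_dqp :: "dqp \<Rightarrow> dqp" is split_dq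
  by (rule split_dq_iso)

lift_definition pic_count :: "dqp \<Rightarrow> dqp \<Rightarrow> nat" is "\<lambda>P Q. card (Pic P Q)"
  by (rule card_pictures_iso(2))

lift_definition pic_strict_count :: "dqp \<Rightarrow> dqp \<Rightarrow> nat" is "\<lambda>P Q. card (Pic_strict P Q)"
  by (rule card_pictures_iso(1))


section \<open>Vector spaces with a given basis, and Hopf pairings\<close>

text \<open>\<open>'b \<Rightarrow>\<^sub>0 'k\<close> is the \<open>'k\<close>-vector space with basis \<open>'b\<close> (the basis vector of \<open>b\<close> being
  \<open>Poly_Mapping.single b 1\<close>); its tensor square is \<open>'b \<times> 'b \<Rightarrow>\<^sub>0 'k\<close>, where \<open>(a, b)\<close> stands for
  \<open>a \<otimes> b\<close>.\<close>

definition scale :: "'k::field \<Rightarrow> ('b \<Rightarrow>\<^sub>0 'k) \<Rightarrow> ('b \<Rightarrow>\<^sub>0 'k)" where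
  "scale c x = Poly_Mapping.map ((*) c) x"

lemma lookup_scale [simp]: "Poly_Mapping.lookup (scale c x) b = c * Poly_Mapping.lookup x b"
  unfolding scale_def by (simp add: map.rep_eq when_def)

lemma vector_space_scale: "vector_space (scale :: 'k::field \<Rightarrow> ('b \<Rightarrow>\<^sub>0 'k) \<Rightarrow> _)"
  by unfold_locales (auto intro!: poly_mapping_eqI simp: lookup_add algebra_simps)

definition linear_ext :: "('b \<Rightarrow> ('c \<Rightarrow>\<^sub>0 'k)) \<Rightarrow> ('b \<Rightarrow>\<^sub>0 'k) \<Rightarrow> ('c \<Rightarrow>\<^sub>0 'k::field)" where
  "linear_ext f x = (\<Sum>b\<in>Poly_Mapping.keys x. scale (Poly_Mapping.lookup x b) (f b))"

definition bilinear_form_ext :: "('b \<Rightarrow> 'b \<Rightarrow> 'k) \<Rightarrow> ('b \<Rightarrow>\<^sub>0 'k) \<Rightarrow> ('b \<Rightarrow>\<^sub>0 'k) \<Rightarrow> 'k::field" where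
  "bilinear_form_ext B x y = (\<Sum>a\<in>Poly_Mapping.keys x. \<Sum>b\<in>Poly_Mapping.keys y.
     Poly_Mapping.lookup x a * Poly_Mapping.lookup y b * B a b)"

definition tensor :: "('b \<Rightarrow>\<^sub>0 'k) \<Rightarrow> ('b \<Rightarrow>\<^sub>0 'k) \<Rightarrow> ('b \<times> 'b \<Rightarrow>\<^sub>0 'k::field)" where
  "tensor x y = (\<Sum>a\<in>Poly_Mapping.keys x. \<Sum>b\<in>Poly_Mapping.keys y.
     Poly_Mapping.single (a, b) (Poly_Mapping.lookup x a * Poly_Mapping.lookup y b))"

definition tensor_form ::
  "(('b \<Rightarrow>\<^sub>0 'k) \<Rightarrow> ('b \<Rightarrow>\<^sub>0 'k) \<Rightarrow> 'k) \<Rightarrow> ('b \<times> 'b \<Rightarrow>\<^sub>0 'k) \<Rightarrow> ('b \<times> 'b \<Rightarrow>\<^sub>0 'k) \<Rightarrow> 'k::field" where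
  "tensor_form B = bilinear_form_ext (\<lambda>(a, b) (c, d).
     B (Poly_Mapping.single a 1) (Poly_Mapping.single c 1) *
     B (Poly_Mapping.single b 1) (Poly_Mapping.single d 1))"

definition bilinear_form :: "(('b \<Rightarrow>\<^sub>0 'k) \<Rightarrow> ('b \<Rightarrow>\<^sub>0 'k) \<Rightarrow> 'k::field) \<Rightarrow> bool" where
  "bilinear_form B \<longleftrightarrow> (\<forall>x. Vector_Spaces.linear scale (*) (\<lambda>y. B x y)) \<and>
     (\<forall>y. Vector_Spaces.linear scale (*) (\<lambda>x. B x y))"

definition symmetric_form :: "('v \<Rightarrow> 'v \<Rightarrow> 'k) \<Rightarrow> bool" where
  "symmetric_form B \<longleftrightarrow> (\<forall>x y. B x y = B y x)"

definition hopf_pairing ::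
  "(('b \<Rightarrow>\<^sub>0 'k) \<Rightarrow> ('b \<Rightarrow>\<^sub>0 'k) \<Rightarrow> ('b \<Rightarrow>\<^sub>0 'k)) \<Rightarrow> ('b \<Rightarrow>\<^sub>0 'k) \<Rightarrow>
   (('b \<Rightarrow>\<^sub>0 'k) \<Rightarrow> ('b \<times> 'b \<Rightarrow>\<^sub>0 'k)) \<Rightarrow> (('b \<Rightarrow>\<^sub>0 'k) \<Rightarrow> 'k) \<Rightarrow>
   (('b \<Rightarrow>\<^sub>0 'k) \<Rightarrow> ('b \<Rightarrow>\<^sub>0 'k) \<Rightarrow> 'k::field) \<Rightarrow> bool" where
  "hopf_pairing m u \<Delta> \<epsilon> B \<longleftrightarrow> bilinear_form B \<and>
     (\<forall>x y z. B (m x y) z = tensor_form B (tensor x y) (\<Delta> z)) \<and>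
     (\<forall>x y z. B x (m y z) = tensor_form B (\<Delta> x) (tensor y z)) \<and>
     (\<forall>x. B u x = \<epsilon> x) \<and> (\<forall>x. B x u = \<epsilon> x)"


section \<open>The Hopf algebra of double quasi-posets\<close>

definition sum_cuts :: "('a dqposet \<Rightarrow> 'a set set) \<Rightarrow> 'a dqposet \<Rightarrow> (dqp \<times> dqp \<Rightarrow>\<^sub>0 'k::field)" where
  "sum_cuts T P = (\<Sum>X\<in>T P. Poly_Mapping.single
     (iso_class (restrict_dq P (verts P - X)), iso_class (restrict_dq P X)) 1)"

lemma sum_cuts_iso:
  assumes f: "is_dq_iso f P Q" and T: "T' Q = (`) f ` T P" and sub: "\<And>X. X \<in> T P \<Longrightarrow> X \<subseteq> verts P"
  shows "sum_cuts T P = sum_cuts T' Q"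
proof -
  have inj: "inj_on f (verts P)" and im: "f ` verts P = verts Q"
    using f by (auto simp: is_dq_iso_def bij_betw_def)
  have inj': "inj_on ((`) f) (T P)"
    by (rule inj_onI) (meson inj inj_on_image_eq_iff sub)
  show ?thesis
    unfolding sum_cuts_def T sum.reindex[OF inj'] o_def
  proof (rule sum.cong[OF refl])
    fix X assume "X \<in> T P"
    then have X: "X \<subseteq> verts P" by (rule sub)
    then have "f ` (verts P - X) = verts Q - f ` X"
      using inj im by (simp add: inj_on_image_set_diff[OF inj])
    then have "dq_iso (restrict_dq P X) (restrict_dq Q (f ` X))"
      "dq_iso (restrict_dq P (verts P - X)) (restrict_dq Q (verts Q - f ` X))"
      using is_dq_iso_restrict[OF f X] is_dq_iso_restrict[OF f, of "verts P - X"]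
      unfolding dq_iso_def by auto
    then have "iso_class (restrict_dq P X) = iso_class (restrict_dq Q (f ` X))"
      "iso_class (restrict_dq P (verts P - X)) = iso_class (restrict_dq Q (verts Q - f ` X))"
      by (simp_all only: iso_class_eq_iff)
    then show "Poly_Mapping.single
        (iso_class (restrict_dq P (verts P - X)), iso_class (restrict_dq P X)) 1 =
      Poly_Mapping.single
        (iso_class (restrict_dq Q (verts Q - f ` X)), iso_class (restrict_dq Q (f ` X))) 1"
      by (simp only:)
  qed
qed

lift_definition coprod_dqp :: "dqp \<Rightarrow> (dqp \<times> dqp \<Rightarrow>\<^sub>0 'k::field)" is "sum_cuts Top"
proof -
  fix P Q :: "nat dqposet" assume "dq_iso P Q"
  then obtain f where f: "is_dq_iso f P Q" by (auto simp: dq_iso_def)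
  then have "Top Q = (`) f ` Top P"
    unfolding Top_def by (intro upsets_iso) (auto simp: is_dq_iso_def)
  then show "sum_cuts Top P = (sum_cuts Top Q :: (dqp \<times> dqp \<Rightarrow>\<^sub>0 'k))"
    by (rule sum_cuts_iso[OF f]) (auto simp: Top_def upsets_def)
qed

lift_definition coprod_strict_dqp :: "dqp \<Rightarrow> (dqp \<times> dqp \<Rightarrow>\<^sub>0 'k::field)" is "sum_cuts Top_strict"
proof -
  fix P Q :: "nat dqposet" assume "dq_iso P Q"
  then obtain f where f: "is_dq_iso f P Q" by (auto simp: dq_iso_def)
  then have "Top_strict Q = (`) f ` Top_strict P"
    unfolding Top_strict_def
    by (intro upsets_iso is_dq_iso_strict(1)[OF f]) (auto simp: is_dq_iso_def)
  then show "sum_cuts Top_strict P = (sum_cuts Top_strict Q :: (dqp \<times> dqp \<Rightarrow>\<^sub>0 'k))"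
    by (rule sum_cuts_iso[OF f]) (auto simp: Top_strict_def upsets_def)
qed

definition coproduct :: "(dqp \<Rightarrow>\<^sub>0 'k) \<Rightarrow> (dqp \<times> dqp \<Rightarrow>\<^sub>0 'k::field)" where
  "coproduct = linear_ext coprod_dqp"

definition coproduct_strict :: "(dqp \<Rightarrow>\<^sub>0 'k) \<Rightarrow> (dqp \<times> dqp \<Rightarrow>\<^sub>0 'k::field)" where
  "coproduct_strict = linear_ext coprod_strict_dqp"

text \<open>The counit of both coproducts is the coefficient of the empty double quasi-poset, i.e. the
  projection to degree \<open>0\<close>.\<close>

definition counit :: "(dqp \<Rightarrow>\<^sub>0 'k) \<Rightarrow> 'k::field" where
  "counit x = Poly_Mapping.lookup x 0"

definition pos :: "(dqp \<Rightarrow>\<^sub>0 'k) \<Rightarrow> (dqp \<Rightarrow>\<^sub>0 'k::field)" where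
  "pos = linear_ext (\<lambda>P. Poly_Mapping.single (pos_dqp P) 1)"

definition pairing :: "(dqp \<Rightarrow>\<^sub>0 'k) \<Rightarrow> (dqp \<Rightarrow>\<^sub>0 'k) \<Rightarrow> 'k::field" where
  "pairing = bilinear_form_ext (\<lambda>P Q. of_nat (pic_count P Q))"

definition pairing_strict :: "(dqp \<Rightarrow>\<^sub>0 'k) \<Rightarrow> (dqp \<Rightarrow>\<^sub>0 'k) \<Rightarrow> 'k::field" where
  "pairing_strict = bilinear_form_ext (\<lambda>P Q. of_nat (pic_strict_count P Q))"

abbreviation basis :: "'a dqposet \<Rightarrow> (dqp \<Rightarrow>\<^sub>0 'k::field)" where
  "basis P \<equiv> Poly_Mapping.single (iso_class P) 1"

lemma times_basis: "basis P * basis Q = (basis (prod_dq P Q) :: dqp \<Rightarrow>\<^sub>0 'k::field)"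
  by (simp add: mult_single plus_iso_class)

lemma one_basis: "(1 :: dqp \<Rightarrow>\<^sub>0 'k::field) = basis empty_dq"
  by (simp only: zero_iso_class single_one)

lemma tensor_basis: "tensor (basis P) (basis Q) =
    (Poly_Mapping.single (iso_class P, iso_class Q) 1 :: _ \<Rightarrow>\<^sub>0 'k::field)"
  by (simp add: tensor_def)

lemma linear_ext_single: "linear_ext f (Poly_Mapping.single b 1) = (f b :: _ \<Rightarrow>\<^sub>0 'k::field)"
  by (auto simp: linear_ext_def intro: poly_mapping_eqI)

lemma pos_basis: "pos (basis P) = (basis (split_dq P) :: dqp \<Rightarrow>\<^sub>0 'k::field)"
proof -
  obtain N :: "nat dqposet" where N: "dq_iso P N" using ex_nat_dqposet by blast
  then have "iso_class P = abs_dqp N" "iso_class (split_dq P) = abs_dqp (split_dq N)"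
    using split_dq_iso[OF N] by (simp_all only: iso_class_eq_iff flip: iso_class_nat)
  then show ?thesis by (simp add: pos_def linear_ext_single pos_dqp.abs_eq)
qed

lemma coproduct_basis: "coproduct (basis P) = (sum_cuts Top P :: _ \<Rightarrow>\<^sub>0 'k::field)"
proof -
  obtain N :: "nat dqposet" and f where f: "is_dq_iso f P N"
    using ex_nat_dqposet[of P] by (auto simp: dq_iso_def)
  then have "iso_class P = iso_class N" by (auto simp only: iso_class_eq_iff dq_iso_def)
  moreover have "Top N = (`) f ` Top P"
    using f unfolding Top_def by (intro upsets_iso) (auto simp: is_dq_iso_def)
  then have "sum_cuts Top P = (sum_cuts Top N :: _ \<Rightarrow>\<^sub>0 'k)"
    by (rule sum_cuts_iso[OF f]) (auto simp: Top_def upsets_def)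
  ultimately show ?thesis by (simp add: coproduct_def linear_ext_single coprod_dqp.abs_eq)
qed

lemma coproduct_strict_basis:
  "coproduct_strict (basis P) = (sum_cuts Top_strict P :: _ \<Rightarrow>\<^sub>0 'k::field)"
proof -
  obtain N :: "nat dqposet" and f where f: "is_dq_iso f P N"
    using ex_nat_dqposet[of P] by (auto simp: dq_iso_def)
  then have "iso_class P = iso_class N" by (auto simp only: iso_class_eq_iff dq_iso_def)
  moreover have "Top_strict N = (`) f ` Top_strict P"
    unfolding Top_strict_def
    by (intro upsets_iso is_dq_iso_strict(1)[OF f]) (use f in \<open>auto simp: is_dq_iso_def\<close>)
  then have "sum_cuts Top_strict P = (sum_cuts Top_strict N :: _ \<Rightarrow>\<^sub>0 'k)"
    by (rule sum_cuts_iso[OF f]) (auto simp: Top_strict_def upsets_def)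
  ultimately show ?thesis
    by (simp add: coproduct_strict_def linear_ext_single coprod_strict_dqp.abs_eq)
qed

lemma pairings_basis:
  "pairing (basis P) (basis Q) = (of_nat (card (Pic P Q)) :: 'k::field)"
  "pairing_strict (basis P) (basis Q) = (of_nat (card (Pic_strict P Q)) :: 'k::field)"
proof -
  obtain M N :: "nat dqposet" where MN: "dq_iso P M" "dq_iso Q N"
    using ex_nat_dqposet by meson
  then have "iso_class P = abs_dqp M" "iso_class Q = abs_dqp N"
    by (simp_all only: iso_class_eq_iff flip: iso_class_nat)
  then show "pairing (basis P) (basis Q) = (of_nat (card (Pic P Q)) :: 'k)"
    "pairing_strict (basis P) (basis Q) = (of_nat (card (Pic_strict P Q)) :: 'k)"
    by (simp_all add: pairing_def pairing_strict_def bilinear_form_ext_def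
        pic_count.abs_eq pic_strict_count.abs_eq card_pictures_iso[OF MN])
qed

end

theory Submission
  imports Defs
begin

text \<open>The coproduct identity is a bijection: a picture \<open>f\<close> between \<open>PQ\<close> and \<open>R\<close> cuts \<open>R\<close> along
  \<open>X = f(V(Q))\<close>. As every vertex of \<open>P\<close> lies \<open><\<^sub>2\<close>-below every vertex of \<open>Q\<close>, the condition on
  \<open>f\<inverse>\<close> across the two blocks says exactly that \<open>X\<close> is an upper set of \<open>R\<close>, and what remains of
  the conditions on \<open>f\<close> concerns its two restrictions \<open>P \<rightarrow> R - X\<close> and \<open>Q \<rightarrow> X\<close> separately.
  Inverting bijections gives symmetry, which turns the first Hopf axiom into the second. Splitting
  does not change the strict relations, and in a split poset the weak conditions on a bijection
  follow from the strict ones.\<close>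

section \<open>Linear algebra on a space with a basis\<close>

lemma vector_space_mult: "vector_space ((*) :: 'k::field \<Rightarrow> _)"
  by unfold_locales (auto simp: algebra_simps)

text \<open>Off the support the coefficient is 0. This allows sums over different supports to be
  compared over one common finite set.\<close>

lemma sum_keys_superset:
  fixes s :: "'k::field \<Rightarrow> 'v::ab_group_add \<Rightarrow> 'v"
  assumes "vector_space s" "finite A" "Poly_Mapping.keys x \<subseteq> A"
  shows "(\<Sum>a\<in>Poly_Mapping.keys x. s (Poly_Mapping.lookup x a) (f a)) =
    (\<Sum>a\<in>A. s (Poly_Mapping.lookup x a) (f a))"
proof -
  interpret vector_space s by fact
  show ?thesis using assms by (intro sum.mono_neutral_left) (auto simp: in_keys_iff)
qed

lemma keys_scale_subset: "Poly_Mapping.keys (scale c x) \<subseteq> Poly_Mapping.keys x"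
  by (auto simp: in_keys_iff)

lemma linear_sum_keys:
  fixes s :: "'k::field \<Rightarrow> 'v::ab_group_add \<Rightarrow> 'v" and f :: "'b \<Rightarrow> 'v"
  assumes "vector_space s"
  shows "Vector_Spaces.linear scale s
    (\<lambda>x. \<Sum>a\<in>Poly_Mapping.keys x. s (Poly_Mapping.lookup x a) (f a))"
proof -
  interpret vector_space s by fact
  show ?thesis
    unfolding Vector_Spaces.linear_iff
  proof (intro conjI allI)
    fix x y :: "'b \<Rightarrow>\<^sub>0 'k"
    let ?A = "Poly_Mapping.keys x \<union> Poly_Mapping.keys y"
    note sup = sum_keys_superset[OF assms, of ?A _ f]
    show "(\<Sum>a\<in>Poly_Mapping.keys (x + y). s (Poly_Mapping.lookup (x + y) a) (f a)) =
      (\<Sum>a\<in>Poly_Mapping.keys x. s (Poly_Mapping.lookup x a) (f a)) +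
      (\<Sum>a\<in>Poly_Mapping.keys y. s (Poly_Mapping.lookup y a) (f a))"
      \<comment> \<open>The three supports differ, by cancellation for instance, so all sums are
        moved to the union \<open>?A\<close>.\<close>
      unfolding sup[of "x + y", OF _ Poly_Mapping.keys_add, simplified]
      by (simp add: sup[of x] sup[of y] lookup_add scale_left_distrib sum.distrib)
  next
    fix c and x :: "'b \<Rightarrow>\<^sub>0 'k"
    show "(\<Sum>a\<in>Poly_Mapping.keys (scale c x). s (Poly_Mapping.lookup (scale c x) a) (f a)) =
      s c (\<Sum>a\<in>Poly_Mapping.keys x. s (Poly_Mapping.lookup x a) (f a))"
      unfolding sum_keys_superset[OF assms finite_keys keys_scale_subset]
      by (simp add: scale_sum_right)
  qed (fact vector_space_scale assms)+
qed

lemma sum_singles_eq: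
  "(\<Sum>a\<in>Poly_Mapping.keys x. scale (Poly_Mapping.lookup x a) (Poly_Mapping.single a 1)) = x"
  by (rule poly_mapping_eqI) (auto simp: lookup_sum lookup_single when_def in_keys_iff if_distrib
      cong: if_cong)

text \<open>By \<open>sum_singles_eq\<close>, \<open>x\<close> is a finite combination of basis
  vectors, and both maps commute with such combinations.\<close>

lemma linear_eqI:
  assumes f: "Vector_Spaces.linear scale s f" and g: "Vector_Spaces.linear scale s g"
    and eq: "\<And>b. f (Poly_Mapping.single b 1) = g (Poly_Mapping.single b 1)"
  shows "f x = g x"
proof -
  interpret f: Vector_Spaces.linear scale s f by fact
  interpret g: Vector_Spaces.linear scale s g by fact
  let ?x = "\<Sum>a\<in>Poly_Mapping.keys x. scale (Poly_Mapping.lookup x a) (Poly_Mapping.single a 1)"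
  have "f ?x = g ?x" by (simp add: f.sum g.sum f.scale g.scale eq)
  then show ?thesis by (simp only: sum_singles_eq)
qed

section \<open>Bilinear extensions and tensors\<close>

lemma linear_linear_ext: "Vector_Spaces.linear scale scale (linear_ext f)"
  unfolding linear_ext_def by (rule linear_sum_keys[OF vector_space_scale])

lemma bilinear_form_linear:
  assumes "bilinear_form B"
  shows "Vector_Spaces.linear scale (*) (B x)" "Vector_Spaces.linear scale (*) (\<lambda>x. B x y)"
  using assms by (auto simp: bilinear_form_def)

lemma bilinear_form_bilinear_form_ext: "bilinear_form (bilinear_form_ext B)"
  unfolding bilinear_form_def
proof (intro conjI allI)
  fix x
  \<comment> \<open>With one argument fixed, the inner sum serves as the coefficient family of
    \<open>linear_sum_keys\<close>; for the second argument the sums are first interchanged.\<close>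
  have "bilinear_form_ext B x y = (\<Sum>b\<in>Poly_Mapping.keys y. Poly_Mapping.lookup y b *
      (\<Sum>a\<in>Poly_Mapping.keys x. Poly_Mapping.lookup x a * B a b))" for y
    unfolding bilinear_form_ext_def
    by (subst sum.swap) (simp add: sum_distrib_left mult_ac)
  then show "Vector_Spaces.linear scale (*) (\<lambda>y. bilinear_form_ext B x y)"
    by (simp only: linear_sum_keys[OF vector_space_mult])
next
  fix y
  have "bilinear_form_ext B x y = (\<Sum>a\<in>Poly_Mapping.keys x. Poly_Mapping.lookup x a *
      (\<Sum>b\<in>Poly_Mapping.keys y. Poly_Mapping.lookup y b * B a b))" for x
    unfolding bilinear_form_ext_def by (simp add: sum_distrib_left mult_ac)
  then show "Vector_Spaces.linear scale (*) (\<lambda>x. bilinear_form_ext B x y)"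
    by (simp only: linear_sum_keys[OF vector_space_mult])
qed

lemma bilinear_form_tensor_form: "bilinear_form (tensor_form B)"
  unfolding tensor_form_def by (rule bilinear_form_bilinear_form_ext)

lemma scale_single: "scale c (Poly_Mapping.single a d) = Poly_Mapping.single a (c * d)"
  by (rule poly_mapping_eqI) (auto simp: lookup_single when_def)

lemma scale_sum: "scale c (sum f A) = (\<Sum>a\<in>A. scale c (f a))"
proof -
  interpret vector_space scale by (rule vector_space_scale)
  show ?thesis by (rule scale_sum_right)
qed

lemma linear_tensor:
  "Vector_Spaces.linear scale scale (tensor x)" "Vector_Spaces.linear scale scale (\<lambda>x. tensor x y)"
proof -
  have "tensor x y = (\<Sum>b\<in>Poly_Mapping.keys y. scale (Poly_Mapping.lookup y b)
      (\<Sum>a\<in>Poly_Mapping.keys x. Poly_Mapping.single (a, b) (Poly_Mapping.lookup x a)))" for y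
    unfolding tensor_def by (subst sum.swap) (simp add: scale_sum scale_single mult.commute)
  then have "tensor x = (\<lambda>y. \<Sum>b\<in>Poly_Mapping.keys y. scale (Poly_Mapping.lookup y b)
      (\<Sum>a\<in>Poly_Mapping.keys x. Poly_Mapping.single (a, b) (Poly_Mapping.lookup x a)))" ..
  then show "Vector_Spaces.linear scale scale (tensor x)"
    by (simp only: linear_sum_keys[OF vector_space_scale])
  have "tensor x y = (\<Sum>a\<in>Poly_Mapping.keys x. scale (Poly_Mapping.lookup x a)
      (\<Sum>b\<in>Poly_Mapping.keys y. Poly_Mapping.single (a, b) (Poly_Mapping.lookup y b)))" for x
    unfolding tensor_def by (simp add: scale_sum scale_single)
  then show "Vector_Spaces.linear scale scale (\<lambda>x. tensor x y)"
    by (simp only: linear_sum_keys[OF vector_space_scale])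
qed

section \<open>Bilinearity of the product\<close>

lemma scale_eq_mult: "scale c x = Poly_Mapping.single 0 c * (x :: 'b::monoid_add \<Rightarrow>\<^sub>0 'k::field)"
  unfolding scale_def by (rule mult_map_scale_conv_mult)

text \<open>The product is not commutative, so multiplication by a constant from the right needs its
  own proof. With constants available on both sides, associativity gives linearity in each
  factor.\<close>

lemma scale_eq_mult': "scale c x = (x :: 'b::monoid_add \<Rightarrow>\<^sub>0 'k::field) * Poly_Mapping.single 0 c"
proof (rule poly_mapping_eqI)
  fix b
  \<comment> \<open>In this order of conditions the convolution sum collapses, first at
    \<open>q = 0\<close> and then at \<open>l = b\<close>.\<close>
  have "((c when 0 = q) when b = l + q) = ((c when b = l) when q = 0)" for l q :: 'b
    by (auto simp: when_def)
  then show "Poly_Mapping.lookup (scale c x) b = Poly_Mapping.lookup (x * Poly_Mapping.single 0 c) b"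
    by (simp add: lookup_mult lookup_single mult_when mult.commute)
qed

lemma linear_times:
  fixes x :: "'b::monoid_add \<Rightarrow>\<^sub>0 'k::field"
  shows "Vector_Spaces.linear scale scale ((*) x)" "Vector_Spaces.linear scale scale (\<lambda>x. x * y)"
proof -
  have "x * scale c y = scale c (x * y)" for c y
    by (simp add: scale_eq_mult' mult.assoc)
  then show "Vector_Spaces.linear scale scale ((*) x)"
    by (simp add: Vector_Spaces.linear_iff vector_space_scale distrib_left)
  have "scale c x * y = scale c (x * y)" for c x
    by (simp add: scale_eq_mult mult.assoc)
  then show "Vector_Spaces.linear scale scale (\<lambda>x. x * y)"
    by (simp add: Vector_Spaces.linear_iff vector_space_scale distrib_right)
qed

section \<open>Hopf pairings checked on a basis\<close>

lemma linear_lookup: "Vector_Spaces.linear scale (*) (\<lambda>x. Poly_Mapping.lookup x b)"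
  by (auto simp: Vector_Spaces.linear_iff vector_space_scale vector_space_mult lookup_add)

text \<open>The library fact with the composite written as \<open>\<lambda>x. g (f x)\<close>, the
  form in which composites arise below.\<close>

lemma linear_compose:
  "Vector_Spaces.linear r s f \<Longrightarrow> Vector_Spaces.linear s t g \<Longrightarrow> Vector_Spaces.linear r t (\<lambda>x. g (f x))"
  using Vector_Spaces.linear_compose[of r s f t g] by (simp add: o_def)

lemma tensor_form_single:
  "tensor_form B (Poly_Mapping.single (a, b) 1) (Poly_Mapping.single (c, d) 1) =
    B (Poly_Mapping.single a 1) (Poly_Mapping.single c 1) *
    B (Poly_Mapping.single b 1) (Poly_Mapping.single d 1)"
  by (simp add: tensor_form_def bilinear_form_ext_def)

lemma bilinear_form_eqI:
  assumes B: "bilinear_form B" and C: "bilinear_form C"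
    and eq: "\<And>a b. B (Poly_Mapping.single a 1) (Poly_Mapping.single b 1) =
      C (Poly_Mapping.single a 1) (Poly_Mapping.single b 1)"
  shows "B x y = C x y"
proof (rule linear_eqI[OF bilinear_form_linear(2)[OF B] bilinear_form_linear(2)[OF C]])
  fix a
  show "B (Poly_Mapping.single a 1) y = C (Poly_Mapping.single a 1) y"
    by (rule linear_eqI[OF bilinear_form_linear(1)[OF B] bilinear_form_linear(1)[OF C] eq])
qed

lemma bilinear_form_flip: "bilinear_form B \<Longrightarrow> bilinear_form (\<lambda>x y. B y x)"
  by (auto simp: bilinear_form_def)

lemma symmetric_tensor_form:
  assumes "symmetric_form B"
  shows "tensor_form B x y = tensor_form B y x"
proof (rule bilinear_form_eqI[OF bilinear_form_tensor_form
      bilinear_form_flip[OF bilinear_form_tensor_form]])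
  fix p q :: "'a \<times> 'a"
  have sym: "B u v = B v u" for u v using assms by (simp add: symmetric_form_def)
  obtain a b c d where pq: "p = (a, b)" "q = (c, d)" by (cases p, cases q)
  show "tensor_form B (Poly_Mapping.single p 1) (Poly_Mapping.single q 1) =
      tensor_form B (Poly_Mapping.single q 1) (Poly_Mapping.single p 1)"
    unfolding pq tensor_form_single
    by (rule arg_cong2[where f = "(*)"]; rule sym)
qed

text \<open>All maps involved are linear, so basis vectors suffice. Symmetry of \<open>B\<close>
  passes to \<open>tensor_form B\<close>, hence the axioms for a product and for the unit in the
  second argument are mirror images of those in the first.\<close>

lemma symmetric_hopf_pairing_extI:
  fixes B :: "('b::monoid_add \<Rightarrow>\<^sub>0 'k::field) \<Rightarrow> _"
  assumes B: "bilinear_form B" and \<Delta>: "Vector_Spaces.linear scale scale \<Delta>"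
    and \<epsilon>: "Vector_Spaces.linear scale (*) \<epsilon>"
    and sym: "\<And>a b. B (Poly_Mapping.single a 1) (Poly_Mapping.single b 1) =
      B (Poly_Mapping.single b 1) (Poly_Mapping.single a 1)"
    and mult: "\<And>a b c. B (Poly_Mapping.single a 1 * Poly_Mapping.single b 1) (Poly_Mapping.single c 1) =
      tensor_form B (tensor (Poly_Mapping.single a 1) (Poly_Mapping.single b 1))
        (\<Delta> (Poly_Mapping.single c 1))"
    and unit: "\<And>a. B 1 (Poly_Mapping.single a 1) = \<epsilon> (Poly_Mapping.single a 1)"
  shows "hopf_pairing (*) 1 \<Delta> \<epsilon> B \<and> symmetric_form B"
proof -
  note B_lin = bilinear_form_linear[OF B]
  note T_lin = bilinear_form_linear[OF bilinear_form_tensor_form]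
  have sym': "B x y = B y x" for x y
    by (rule bilinear_form_eqI[OF B bilinear_form_flip[OF B] sym])
  then have sf: "symmetric_form B" by (simp add: symmetric_form_def)
  have mult': "B (x * y) z = tensor_form B (tensor x y) (\<Delta> z)" for x y z
  proof -
    \<comment> \<open>The identity is trilinear; basis vectors are replaced by arbitrary ones in
      \<open>z\<close>, then \<open>y\<close>, then \<open>x\<close>.\<close>
    have 1: "B (Poly_Mapping.single a 1 * Poly_Mapping.single b 1) z =
        tensor_form B (tensor (Poly_Mapping.single a 1) (Poly_Mapping.single b 1)) (\<Delta> z)" for a b
      by (rule linear_eqI[OF B_lin(1) linear_compose[OF \<Delta> T_lin(1)] mult])
    have 2: "B (Poly_Mapping.single a 1 * y) z =
        tensor_form B (tensor (Poly_Mapping.single a 1) y) (\<Delta> z)" for a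
      by (rule linear_eqI[OF linear_compose[OF linear_times(1) B_lin(2)]
            linear_compose[OF linear_tensor(1) T_lin(2)] 1])
    show ?thesis
      by (rule linear_eqI[OF linear_compose[OF linear_times(2) B_lin(2)]
            linear_compose[OF linear_tensor(2) T_lin(2)] 2])
  qed
  have "B x (y * z) = tensor_form B (\<Delta> x) (tensor y z)" for x y z
    by (metis sym' mult' symmetric_tensor_form[OF sf])
  moreover have "B 1 x = \<epsilon> x" for x
    by (rule linear_eqI[OF B_lin(1) \<epsilon> unit])
  ultimately show ?thesis
    using B sf mult' sym' by (auto simp: hopf_pairing_def)
qed

section \<open>Pictures\<close>

text \<open>The relations are parameters, so that the strict and the weak conditions are both
  instances and can share the lemmas on cutting and inversion.\<close>

definition compat :: "'a set \<Rightarrow> 'a rel \<Rightarrow> 'a rel \<Rightarrow> 'b rel \<Rightarrow> 'b rel \<Rightarrow> ('a \<Rightarrow> 'b) \<Rightarrow> bool" where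
  "compat V r1 r2 s1 s2 f \<longleftrightarrow> (\<forall>i\<in>V. \<forall>j\<in>V.
     ((i, j) \<in> r1 \<longrightarrow> (f i, f j) \<in> s2) \<and> ((f i, f j) \<in> s1 \<longrightarrow> (i, j) \<in> r2))"

definition bijs :: "'a set \<Rightarrow> 'b set \<Rightarrow> ('a \<Rightarrow> 'b) set" where
  "bijs V W = {f \<in> V \<rightarrow>\<^sub>E W. bij_betw f V W}"

lemma bijs_iff: "f \<in> bijs V W \<longleftrightarrow> f \<in> extensional V \<and> inj_on f V \<and> f ` V = W"
  by (auto simp: bijs_def bij_betw_def PiE_def)

lemma Pic_strict_eq: "Pic_strict P Q = {f \<in> bijs (verts P) (verts Q). compat (verts P)
    (strict_rel (rel1 P)) (strict_rel (rel2 P)) (strict_rel (rel1 Q)) (strict_rel (rel2 Q)) f}"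
  by (auto simp: Pic_strict_def bijs_def compat_def)

lemma Pic_eq: "Pic P Q =
    {f \<in> Pic_strict P Q. compat (verts P) (rel1 P) (rel2 P) (rel1 Q) (rel2 Q) f}"
  by (simp add: Pic_def compat_def)

lemma finite_bijs: "finite V \<Longrightarrow> finite W \<Longrightarrow> finite (bijs V W)"
  unfolding bijs_def by (rule finite_subset[of _ "V \<rightarrow>\<^sub>E W"]) (auto intro: finite_PiE)

lemma finite_Pic_strict: "finite (Pic_strict P Q)" and finite_Pic: "finite (Pic P Q)"
  by (auto simp: Pic_strict_eq Pic_eq finite_bijs)

section \<open>Cutting a picture of a product along an upper set\<close>

lemma strict_rel_restrict: "strict_rel (r \<inter> X \<times> X) = strict_rel r \<inter> X \<times> X"
  by (auto simp: strict_rel_def sim_rel_def)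

lemma strict_rel_sum_rel: "strict_rel (sum_rel r s) = sum_rel (strict_rel r) (strict_rel s)"
  by (auto simp: strict_rel_def sim_rel_def sum_rel_def)

text \<open>No pair leads from the right block back to the left one, so every added pair is
  strict.\<close>

lemma strict_rel_sum_rel_ordered:
  "strict_rel (sum_rel r s \<union> {(Inl i, Inr j) | i j. i \<in> V \<and> j \<in> W}) =
    sum_rel (strict_rel r) (strict_rel s) \<union> {(Inl i, Inr j) | i j. i \<in> V \<and> j \<in> W}"
  by (auto simp: strict_rel_def sim_rel_def sum_rel_def)

lemma bijs_sum_iff:
  fixes f :: "'a + 'b \<Rightarrow> 'c"
  assumes "X \<subseteq> U"
  shows "f \<in> bijs (V <+> W) U \<and> f ` Inr ` W = X \<longleftrightarrow>
    f \<circ> Inl \<in> bijs V (U - X) \<and> f \<circ> Inr \<in> bijs W X"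
proof
  assume L: "f \<in> bijs (V <+> W) U \<and> f ` Inr ` W = X"
  then have inj: "inj_on f (V <+> W)" and im: "f ` (V <+> W) = U" and X: "f ` Inr ` W = X"
    and ext: "f \<in> extensional (V <+> W)"
    by (auto simp: bijs_iff)
  \<comment> \<open>By injectivity the left block avoids \<open>X\<close>, and by surjectivity it
    covers the rest of \<open>U\<close>.\<close>
  have "f ` Inl ` V = U - X"
    using im X inj unfolding Plus_def by (auto simp: image_Un dest: inj_onD)
  moreover have "inj_on (f \<circ> Inl) V" "inj_on (f \<circ> Inr) W"
    using inj by (auto simp: inj_on_def)
  moreover have "f \<circ> Inl \<in> extensional V" "f \<circ> Inr \<in> extensional W"
    using ext by (auto simp: extensional_def)
  ultimately show "f \<circ> Inl \<in> bijs V (U - X) \<and> f \<circ> Inr \<in> bijs W X"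
    using X by (simp add: bijs_iff image_comp)
next
  assume R: "f \<circ> Inl \<in> bijs V (U - X) \<and> f \<circ> Inr \<in> bijs W X"
  then have im: "f ` Inl ` V = U - X" "f ` Inr ` W = X"
    and inj: "inj_on (f \<circ> Inl) V" "inj_on (f \<circ> Inr) W"
    and ext: "f \<circ> Inl \<in> extensional V" "f \<circ> Inr \<in> extensional W"
    by (simp_all add: bijs_iff image_comp)
  have "f ` (V <+> W) = U" using im assms unfolding Plus_def by (auto simp: image_Un)
  moreover have "f \<in> extensional (V <+> W)"
    unfolding extensional_def
  proof (intro CollectI allI impI)
    fix x assume "x \<notin> V <+> W"
    then show "f x = undefined" using ext by (cases x) (auto simp: extensional_def)
  qed
  moreover have "inj_on f (V <+> W)"
  proof (rule inj_onI)
    fix x y assume "x \<in> V <+> W" "y \<in> V <+> W" "f x = f y"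
    moreover have "f (Inl i) \<noteq> f (Inr j)" if "i \<in> V" "j \<in> W" for i j using im that by blast
    ultimately show "x = y"
      using inj by (cases x; cases y) (auto simp: inj_on_def dest: sym)
  qed
  ultimately show "f \<in> bijs (V <+> W) U \<and> f ` Inr ` W = X"
    using im by (simp add: bijs_iff)
qed

text \<open>Pairs inside one block give the two restricted conditions. For a mixed pair the first
  relation of the product is empty, so only the backward condition remains: it is automatic from
  left to right, and from right to left it forbids \<open>t1\<close> to leave
  \<open>X\<close>.\<close>

lemma compat_sum_iff:
  fixes f :: "'a + 'b \<Rightarrow> 'c"
  assumes X: "X \<subseteq> U" and fl: "f \<circ> Inl \<in> bijs V (U - X)" and fr: "f \<circ> Inr \<in> bijs W X"
  shows "compat (V <+> W) (sum_rel r1 s1)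
      (sum_rel r2 s2 \<union> {(Inl i, Inr j) | i j. i \<in> V \<and> j \<in> W}) t1 t2 f \<longleftrightarrow>
    X \<in> upsets U t1 \<and>
    compat V r1 r2 (t1 \<inter> (U - X) \<times> (U - X)) (t2 \<inter> (U - X) \<times> (U - X)) (f \<circ> Inl) \<and>
    compat W s1 s2 (t1 \<inter> X \<times> X) (t2 \<inter> X \<times> X) (f \<circ> Inr)"
proof -
  have im: "(\<lambda>i. f (Inl i)) ` V = U - X" "(\<lambda>i. f (Inr i)) ` W = X"
    using fl fr by (auto simp: bijs_def bij_betw_def o_def)
  then have mem: "\<And>i. i \<in> V \<Longrightarrow> f (Inl i) \<in> U" "\<And>i. i \<in> V \<Longrightarrow> f (Inl i) \<notin> X"
    "\<And>i. i \<in> W \<Longrightarrow> f (Inr i) \<in> X" by auto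
  have up: "X \<in> upsets U t1 \<longleftrightarrow> (\<forall>i\<in>W. \<forall>j\<in>V. (f (Inr i), f (Inl j)) \<notin> t1)"
  proof -
    have "X \<in> upsets U t1 \<longleftrightarrow> (\<forall>x\<in>X. \<forall>y\<in>U - X. (x, y) \<notin> t1)"
      using X by (auto simp: upsets_def)
    also have "\<dots> \<longleftrightarrow> (\<forall>x\<in>(\<lambda>i. f (Inr i)) ` W. \<forall>y\<in>(\<lambda>i. f (Inl i)) ` V. (x, y) \<notin> t1)"
      by (simp only: im)
    also have "\<dots> \<longleftrightarrow> (\<forall>i\<in>W. \<forall>j\<in>V. (f (Inr i), f (Inl j)) \<notin> t1)"
      by simp
    finally show ?thesis .
  qed
  have blocks: "(\<forall>x\<in>V <+> W. \<phi> x) \<longleftrightarrow> (\<forall>i\<in>V. \<phi> (Inl i)) \<and> (\<forall>j\<in>W. \<phi> (Inr j))" for \<phi>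
    by auto
  show ?thesis
    unfolding compat_def up blocks using mem by (simp add: ball_conj_distrib) blast
qed

text \<open>\<open>F\<close> is fibred over \<open>T\<close> by the image of the right block.
  Restricting to the two blocks identifies the fibre over \<open>X\<close> with
  \<open>G X \<times> H X\<close>, the inverse being \<open>case_sum\<close>.\<close>

lemma card_cut_sum:
  fixes F :: "('a + 'b \<Rightarrow> 'c) set"
  assumes F: "finite F" and T: "finite T"
    and iff: "\<And>f. f \<in> F \<longleftrightarrow> f ` Inr ` W \<in> T \<and>
      f \<circ> Inl \<in> G (f ` Inr ` W) \<and> f \<circ> Inr \<in> H (f ` Inr ` W)"
    and H: "\<And>X h. X \<in> T \<Longrightarrow> h \<in> H X \<Longrightarrow> h ` W = X"
  shows "card F = (\<Sum>X\<in>T. card (G X) * card (H X))"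
proof -
  \<comment> \<open>By hypothesis \<open>H\<close>, the map \<open>h\<close> alone determines the
    cut, so the glued map lies over \<open>X\<close> itself.\<close>
  have cut: "case_sum g h \<in> {f \<in> F. f ` Inr ` W = X}"
    if "X \<in> T" "g \<in> G X" "h \<in> H X" for X g h
  proof -
    have "case_sum g h ` Inr ` W = X" using H[OF that(1,3)] by (simp add: image_image)
    then show ?thesis using that by (simp add: iff[of "case_sum g h"] case_sum_o_inj)
  qed
  have "card F = card (\<Union>X\<in>T. {f \<in> F. f ` Inr ` W = X})"
    by (rule arg_cong[of _ _ card]) (use iff in auto)
  also have "\<dots> = (\<Sum>X\<in>T. card {f \<in> F. f ` Inr ` W = X})"
    using F T by (intro card_UN_disjoint) auto
  also have "\<dots> = (\<Sum>X\<in>T. card (G X \<times> H X))"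
  proof (rule sum.cong[OF refl])
    fix X assume "X \<in> T"
    have "bij_betw (\<lambda>f. (f \<circ> Inl, f \<circ> Inr)) {f \<in> F. f ` Inr ` W = X} (G X \<times> H X)"
    proof (rule bij_betw_byWitness[where f' = "\<lambda>(g, h). case_sum g h"])
      show "(\<lambda>f. (f \<circ> Inl, f \<circ> Inr)) ` {f \<in> F. f ` Inr ` W = X} \<subseteq> G X \<times> H X"
        using iff by blast
      show "(\<lambda>(g, h). case_sum g h) ` (G X \<times> H X) \<subseteq> {f \<in> F. f ` Inr ` W = X}"
        using cut[OF \<open>X \<in> T\<close>] by (intro image_subsetI) (simp only: case_prod_beta mem_Times_iff)
    qed (auto simp: case_sum_o_inj fun_eq_iff split: sum.split)
    then show "card {f \<in> F. f ` Inr ` W = X} = card (G X \<times> H X)"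
      by (rule bij_betw_same_card)
  qed
  finally show ?thesis by (simp add: card_cartesian_product)
qed

lemma finite_upsets: "finite V \<Longrightarrow> finite (upsets V r)"
  by (rule finite_subset[of _ "Pow V"]) (auto simp: upsets_def)

lemma verts_minus_inter [simp]: "verts P \<inter> (verts P - X) = verts P - X"
  by blast

lemma Pic_strict_prod_iff:
  fixes f :: "'a + 'b \<Rightarrow> 'c"
  assumes "X = f ` Inr ` verts Q"
  shows "f \<in> Pic_strict (prod_dq P Q) R \<longleftrightarrow> X \<in> Top_strict R \<and>
    f \<circ> Inl \<in> Pic_strict P (restrict_dq R (verts R - X)) \<and>
    f \<circ> Inr \<in> Pic_strict Q (restrict_dq R X)"
proof (cases "X \<subseteq> verts R")
  case True
  then have eq: "verts R \<inter> X = X" by blast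
  have b: "f \<in> bijs (verts P <+> verts Q) (verts R) \<longleftrightarrow>
      f \<circ> Inl \<in> bijs (verts P) (verts R - X) \<and> f \<circ> Inr \<in> bijs (verts Q) X"
    using bijs_sum_iff[OF True, of f "verts P" "verts Q"] assms by blast
  show ?thesis
  \<comment> \<open>\<open>compat_sum_iff\<close> presupposes that both blocks are mapped
    bijectively; otherwise neither side can hold.\<close>
  proof (cases "f \<circ> Inl \<in> bijs (verts P) (verts R - X) \<and> f \<circ> Inr \<in> bijs (verts Q) X")
    case True
    then show ?thesis
      using compat_sum_iff[OF \<open>X \<subseteq> verts R\<close>, of f "verts P" "verts Q"]
      by (simp add: Pic_strict_eq Top_strict_def rel1_prod_dq rel2_prod_dq strict_rel_sum_rel
          strict_rel_sum_rel_ordered strict_rel_restrict eq b)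
  next
    case False
    then show ?thesis by (auto simp: Pic_strict_eq eq b)
  qed
next
  case False
  then have "X \<notin> Top_strict R" by (auto simp: Top_strict_def upsets_def)
  moreover have "f \<notin> Pic_strict (prod_dq P Q) R"
    using False assms by (auto simp: Pic_strict_eq bijs_def)
  ultimately show ?thesis by simp
qed

lemma Top_subset_Top_strict: "Top P \<subseteq> Top_strict P"
  by (auto simp: Top_def Top_strict_def upsets_def strict_rel_def)

text \<open>The strict case supplies the bijections and the strict conditions, and
  \<open>compat_sum_iff\<close> is then applied again to the full relations.\<close>

lemma Pic_prod_iff:
  fixes f :: "'a + 'b \<Rightarrow> 'c"
  assumes X: "X = f ` Inr ` verts Q"
  shows "f \<in> Pic (prod_dq P Q) R \<longleftrightarrow> X \<in> Top R \<and>
    f \<circ> Inl \<in> Pic P (restrict_dq R (verts R - X)) \<and> f \<circ> Inr \<in> Pic Q (restrict_dq R X)"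
proof (cases "f \<in> Pic_strict (prod_dq P Q) R")
  case True
  then have s: "X \<in> Top_strict R" "f \<circ> Inl \<in> Pic_strict P (restrict_dq R (verts R - X))"
    "f \<circ> Inr \<in> Pic_strict Q (restrict_dq R X)"
    using Pic_strict_prod_iff[OF X] by auto
  then have sub: "X \<subseteq> verts R" by (auto simp: Top_strict_def upsets_def)
  then have eq: "verts R \<inter> X = X" by blast
  have b: "f \<circ> Inl \<in> bijs (verts P) (verts R - X)" "f \<circ> Inr \<in> bijs (verts Q) X"
    using s by (auto simp: Pic_strict_eq eq)
  show ?thesis
    using True s compat_sum_iff[OF sub b, of "rel1 P" "rel1 Q" "rel2 P" "rel2 Q" "rel1 R" "rel2 R"]
    by (simp add: Pic_eq Top_def rel1_prod_dq rel2_prod_dq)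
next
  case False
  \<comment> \<open>The right-hand side would imply its strict version, since \<open>Top R\<close>
    is contained in \<open>Top_strict R\<close>; so both sides fail.\<close>
  then show ?thesis
    using Pic_strict_prod_iff[OF X, of P R] Top_subset_Top_strict by (auto simp: Pic_eq)
qed

text \<open>The first Hopf axiom on basis vectors, as an identity of natural numbers.\<close>

lemma card_Pic_strict_prod: "card (Pic_strict (prod_dq P Q) R) = (\<Sum>X\<in>Top_strict R.
    card (Pic_strict P (restrict_dq R (verts R - X))) * card (Pic_strict Q (restrict_dq R X)))"
  by (rule card_cut_sum[OF finite_Pic_strict _ Pic_strict_prod_iff[OF refl]])
    (auto simp: Top_strict_def finite_upsets upsets_def Pic_strict_eq bijs_def bij_betw_def)

lemma card_Pic_prod: "card (Pic (prod_dq P Q) R) = (\<Sum>X\<in>Top R.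
    card (Pic P (restrict_dq R (verts R - X))) * card (Pic Q (restrict_dq R X)))"
  by (rule card_cut_sum[OF finite_Pic _ Pic_prod_iff[OF refl]])
    (auto simp: Top_def finite_upsets upsets_def Pic_eq Pic_strict_eq bijs_def bij_betw_def)

section \<open>Inversion of pictures\<close>

lemma compat_inverse:
  assumes "bij_betw f V W" "compat V r1 r2 s1 s2 f"
  shows "compat W s1 s2 r1 r2 (restrict (inv_into V f) W)"
  \<comment> \<open>Inversion exchanges the two implications in \<open>compat\<close>, which is why
    the roles of \<open>r1 r2\<close> and \<open>s1 s2\<close> are swapped.\<close>
  using assms unfolding compat_def
  by (auto simp: bij_betw_def inv_into_into f_inv_into_f)

text \<open>\<open>inv_into\<close> is not extensional; restricting it to \<open>W\<close> makes
  inversion an involution on extensional bijections.\<close>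

lemma bijs_inverse:
  assumes "f \<in> bijs V W"
  shows "restrict (inv_into V f) W \<in> bijs W V"
    and "restrict (inv_into W (restrict (inv_into V f) W)) V = f"
proof -
  have b: "bij_betw f V W" and ext: "f \<in> extensional V" using assms by (auto simp: bijs_def PiE_def)
  let ?g = "restrict (inv_into V f) W"
  have "bij_betw (inv_into V f) W V" by (rule bij_betw_inv_into[OF b])
  then have g: "bij_betw ?g W V" by (simp cong: bij_betw_cong)
  then show "?g \<in> bijs W V" by (auto simp: bijs_def bij_betw_def)
  show "restrict (inv_into W ?g) V = f"
  proof (rule extensionalityI[OF restrict_extensional ext])
    fix i assume "i \<in> V"
    moreover have "f i \<in> W" using b \<open>i \<in> V\<close> by (auto simp: bij_betw_def)
    moreover have "?g (f i) = i" using b \<open>i \<in> V\<close> \<open>f i \<in> W\<close> by (simp add: bij_betw_inv_into_left)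
    ultimately show "restrict (inv_into W ?g) V i = f i"
      using g by (auto simp: bij_betw_def intro: inv_into_f_eq)
  qed
qed

lemma card_Pic_sym:
  "card (Pic_strict P Q) = card (Pic_strict Q P)" "card (Pic P Q) = card (Pic Q P)"
proof -
  \<comment> \<open>Stated for fresh \<open>P\<close> and \<open>Q\<close> of arbitrary vertex
    types, so that it serves for both directions of the bijection.\<close>
  have s: "restrict (inv_into (verts P) f) (verts Q) \<in> Pic_strict Q P"
    if "f \<in> Pic_strict P Q" for f and P :: "'x dqposet" and Q :: "'y dqposet"
    using that bijs_inverse(1)[of f "verts P" "verts Q"] compat_inverse[of f "verts P" "verts Q"]
    by (simp add: Pic_strict_eq) (simp add: bijs_def)
  have w: "restrict (inv_into (verts P) f) (verts Q) \<in> Pic Q P"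
    if "f \<in> Pic P Q" for f and P :: "'x dqposet" and Q :: "'y dqposet"
    using that s[of f P Q] compat_inverse[of f "verts P" "verts Q"]
    by (simp add: Pic_eq) (simp add: Pic_strict_eq bijs_def)
  have inv: "restrict (inv_into (verts Q) (restrict (inv_into (verts P) f) (verts Q))) (verts P) = f"
    if "f \<in> Pic_strict P Q" for f and P :: "'x dqposet" and Q :: "'y dqposet"
    using that by (simp add: Pic_strict_eq bijs_inverse(2))
  show "card (Pic_strict P Q) = card (Pic_strict Q P)"
    by (rule bij_betw_same_card, rule bij_betw_byWitness[where
            f = "\<lambda>f. restrict (inv_into (verts P) f) (verts Q)" and
            f' = "\<lambda>f. restrict (inv_into (verts Q) f) (verts P)"])
      (use s inv in blast)+
  have sub: "Pic P Q \<subseteq> Pic_strict P Q" for P :: "'x dqposet" and Q :: "'y dqposet"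
    by (auto simp: Pic_eq)
  show "card (Pic P Q) = card (Pic Q P)"
    by (rule bij_betw_same_card, rule bij_betw_byWitness[where
            f = "\<lambda>f. restrict (inv_into (verts P) f) (verts Q)" and
            f' = "\<lambda>f. restrict (inv_into (verts Q) f) (verts P)"])
      (use w inv sub in blast)+
qed

section \<open>The empty double quasi-poset and splitting\<close>

lemma card_Pic_empty:
  "card (Pic_strict empty_dq P) = (if verts P = {} then 1 else 0)"
  "card (Pic empty_dq P) = (if verts P = {} then 1 else 0)"
  by (auto simp: Pic_eq Pic_strict_eq bijs_def compat_def bij_betw_def)

text \<open>A strict relation contains no pair together with its reverse, so its pairs stay strict,
  while the added diagonal pairs are equivalences.\<close>

lemma strict_rel_split: "strict_rel (strict_rel r \<union> Id_on V) = strict_rel r"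
  by (auto simp: strict_rel_def sim_rel_def)

lemma Pic_strict_split: "Pic_strict (split_dq P) (split_dq Q) = Pic_strict P Q"
  by (simp add: Pic_strict_eq rel1_split_dq rel2_split_dq strict_rel_split)

text \<open>In a split poset a weak pair is strict or diagonal; diagonal pairs are preserved by any
  map and reflected by an injective one.\<close>

lemma Pic_split: "Pic (split_dq P) (split_dq Q) = Pic_strict (split_dq P) (split_dq Q)"
proof -
  have "compat (verts P) (r1 \<union> Id_on (verts P)) (r2 \<union> Id_on (verts P))
      (s1 \<union> Id_on (verts Q)) (s2 \<union> Id_on (verts Q)) f"
    if "f \<in> bijs (verts P) (verts Q)" "compat (verts P) r1 r2 s1 s2 f" for f r1 r2 s1 s2
    using that by (auto simp: compat_def bijs_def bij_betw_def inj_on_def)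
  then show ?thesis
    by (auto simp: Pic_eq Pic_strict_eq rel1_split_dq rel2_split_dq strict_rel_split)
qed

section \<open>The pairings\<close>

lemma ex_iso_class: "\<exists>P :: nat dqposet. a = iso_class P"
  by (induct a rule: dqp.abs_induct) (metis iso_class_nat)

lemma iso_class_eq_0_iff: "iso_class P = 0 \<longleftrightarrow> verts P = {}"
proof -
  have "iso_class P = 0 \<longleftrightarrow> dq_iso P (empty_dq :: nat dqposet)"
    by (simp only: iso_class_eq_iff flip: zero_iso_class[where 'a = nat])
  also have "\<dots> \<longleftrightarrow> verts P = {}"
    by (auto simp: dq_iso_def is_dq_iso_def bij_betw_def)
  finally show ?thesis .
qed

text \<open>A coproduct of a basis vector is a sum of pure tensors, over which the form is expanded
  by linearity. The result has the shape of the counting formula \<open>card_Pic_prod\<close> and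
  its strict version.\<close>

lemma tensor_form_sum_cuts:
  "tensor_form B (tensor (basis P) (basis Q)) (sum_cuts T R) =
    (\<Sum>X\<in>T R. B (basis P) (basis (restrict_dq R (verts R - X))) * B (basis Q) (basis (restrict_dq R X)))"
proof -
  let ?u = "Poly_Mapping.single (iso_class P, iso_class Q) 1"
  interpret Vector_Spaces.linear scale "(*)" "tensor_form B ?u"
    by (rule bilinear_form_linear(1)[OF bilinear_form_tensor_form])
  show ?thesis by (simp add: sum_cuts_def tensor_basis sum tensor_form_single)
qed

lemma bilinear_form_pairings: "bilinear_form pairing" "bilinear_form pairing_strict"
  unfolding pairing_def pairing_strict_def by (rule bilinear_form_bilinear_form_ext)+

lemma linear_counit: "Vector_Spaces.linear scale (*) counit"
  unfolding counit_def by (rule linear_lookup)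

lemma counit_basis: "counit (basis P) = (if verts P = {} then 1 else 0)"
  by (simp add: counit_def lookup_single iso_class_eq_0_iff)

section \<open>The two Hopf pairings\<close>

lemma hopf_pairing_strict:
  "hopf_pairing (*) 1 coproduct_strict counit
      (pairing_strict :: (dqp \<Rightarrow>\<^sub>0 'k::field) \<Rightarrow> (dqp \<Rightarrow>\<^sub>0 'k) \<Rightarrow> 'k) \<and>
    symmetric_form (pairing_strict :: (dqp \<Rightarrow>\<^sub>0 'k) \<Rightarrow> (dqp \<Rightarrow>\<^sub>0 'k) \<Rightarrow> 'k)"
proof (rule symmetric_hopf_pairing_extI[OF bilinear_form_pairings(2) _ linear_counit])
  show "Vector_Spaces.linear scale scale coproduct_strict"
    unfolding coproduct_strict_def by (rule linear_linear_ext)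
next
  fix a b c :: dqp
  obtain P Q R :: "nat dqposet" where abc: "a = iso_class P" "b = iso_class Q" "c = iso_class R"
    using ex_iso_class by meson
  show "pairing_strict (Poly_Mapping.single a 1) (Poly_Mapping.single b 1) =
      pairing_strict (Poly_Mapping.single b 1) (Poly_Mapping.single a 1)"
    by (simp only: abc pairings_basis card_Pic_sym(1)[of P Q])
  show "pairing_strict (Poly_Mapping.single a 1 * Poly_Mapping.single b 1) (Poly_Mapping.single c 1) =
      tensor_form pairing_strict (tensor (Poly_Mapping.single a 1) (Poly_Mapping.single b 1))
        (coproduct_strict (Poly_Mapping.single c 1))"
    \<comment> \<open>The counting identity holds in the natural numbers and is carried by
      \<open>of_nat\<close> into a field of any characteristic.\<close>
    by (simp only: abc times_basis coproduct_strict_basis tensor_form_sum_cuts pairings_basis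
        card_Pic_strict_prod of_nat_sum of_nat_mult)
  show "pairing_strict 1 (Poly_Mapping.single a 1) = counit (Poly_Mapping.single a 1)"
    \<comment> \<open>The vertex type of the empty double quasi-poset is invisible in
      \<open>1\<close> and has to be chosen.\<close>
    by (simp only: abc one_basis[where 'a = nat] pairings_basis card_Pic_empty counit_basis) simp
qed

lemma hopf_pairing_weak:
  "hopf_pairing (*) 1 coproduct counit
      (pairing :: (dqp \<Rightarrow>\<^sub>0 'k::field) \<Rightarrow> (dqp \<Rightarrow>\<^sub>0 'k) \<Rightarrow> 'k) \<and>
    symmetric_form (pairing :: (dqp \<Rightarrow>\<^sub>0 'k) \<Rightarrow> (dqp \<Rightarrow>\<^sub>0 'k) \<Rightarrow> 'k)"
proof (rule symmetric_hopf_pairing_extI[OF bilinear_form_pairings(1) _ linear_counit])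
  show "Vector_Spaces.linear scale scale coproduct"
    unfolding coproduct_def by (rule linear_linear_ext)
next
  fix a b c :: dqp
  obtain P Q R :: "nat dqposet" where abc: "a = iso_class P" "b = iso_class Q" "c = iso_class R"
    using ex_iso_class by meson
  show "pairing (Poly_Mapping.single a 1) (Poly_Mapping.single b 1) =
      pairing (Poly_Mapping.single b 1) (Poly_Mapping.single a 1)"
    by (simp only: abc pairings_basis card_Pic_sym(2)[of P Q])
  show "pairing (Poly_Mapping.single a 1 * Poly_Mapping.single b 1) (Poly_Mapping.single c 1) =
      tensor_form pairing (tensor (Poly_Mapping.single a 1) (Poly_Mapping.single b 1))
        (coproduct (Poly_Mapping.single c 1))"
    by (simp only: abc times_basis coproduct_basis tensor_form_sum_cuts pairings_basis
        card_Pic_prod of_nat_sum of_nat_mult)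
  show "pairing 1 (Poly_Mapping.single a 1) = counit (Poly_Mapping.single a 1)"
    by (simp only: abc one_basis[where 'a = nat] pairings_basis card_Pic_empty counit_basis) simp
qed

section \<open>Compatibility with splitting\<close>

lemma linear_pos: "Vector_Spaces.linear scale scale pos"
  unfolding pos_def by (rule linear_linear_ext)

lemma bilinear_form_pos: "bilinear_form B \<Longrightarrow> bilinear_form (\<lambda>x y. B (pos x) (pos y))"
  unfolding bilinear_form_def by (auto intro: linear_compose[OF linear_pos])

lemma pairing_strict_pos: "pairing_strict (pos x) (pos y) = pairing_strict x y"
proof (rule bilinear_form_eqI[OF bilinear_form_pos])
  fix a b :: dqp
  obtain P Q :: "nat dqposet" where ab: "a = iso_class P" "b = iso_class Q"
    using ex_iso_class by meson
  show "pairing_strict (pos (Poly_Mapping.single a 1)) (pos (Poly_Mapping.single b 1)) =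
      pairing_strict (Poly_Mapping.single a 1) (Poly_Mapping.single b 1)"
    by (simp only: ab pos_basis pairings_basis Pic_strict_split)
qed (rule bilinear_form_pairings)+

lemma pairing_pos: "pairing (pos x) (pos y) = pairing_strict (pos x) (pos y)"
proof (rule bilinear_form_eqI[OF bilinear_form_pos bilinear_form_pos])
  fix a b :: dqp
  obtain P Q :: "nat dqposet" where ab: "a = iso_class P" "b = iso_class Q"
    using ex_iso_class by meson
  show "pairing (pos (Poly_Mapping.single a 1)) (pos (Poly_Mapping.single b 1)) =
      pairing_strict (pos (Poly_Mapping.single a 1)) (pos (Poly_Mapping.single b 1))"
    by (simp only: ab pos_basis pairings_basis Pic_split)
qed (rule bilinear_form_pairings)+

theorem proposition21:
  shows "(hopf_pairing (*) 1 coproduct_strict counit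
            (pairing_strict :: (dqp \<Rightarrow>\<^sub>0 'k::field) \<Rightarrow> (dqp \<Rightarrow>\<^sub>0 'k) \<Rightarrow> 'k) \<and>
          symmetric_form (pairing_strict :: (dqp \<Rightarrow>\<^sub>0 'k) \<Rightarrow> (dqp \<Rightarrow>\<^sub>0 'k) \<Rightarrow> 'k)) \<and>
         (hopf_pairing (*) 1 coproduct counit
            (pairing :: (dqp \<Rightarrow>\<^sub>0 'k) \<Rightarrow> (dqp \<Rightarrow>\<^sub>0 'k) \<Rightarrow> 'k) \<and>
          symmetric_form (pairing :: (dqp \<Rightarrow>\<^sub>0 'k) \<Rightarrow> (dqp \<Rightarrow>\<^sub>0 'k) \<Rightarrow> 'k)) \<and>
         (\<forall>x y :: dqp \<Rightarrow>\<^sub>0 'k.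
            pairing_strict x y = pairing_strict (pos x) (pos y) \<and>
            pairing_strict (pos x) (pos y) = pairing (pos x) (pos y))"
  by (simp add: hopf_pairing_strict hopf_pairing_weak pairing_strict_pos pairing_pos)

end
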